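(* Let $\mathcal C$ be a class of square-lattice self-avoiding polygons. For $m,n\in\mathbb N_0$ let $p_{m,n}$ be the number of polygons in $\mathcal C$ of half-perimeter $m$ and area $n$, $p_m^{(k)}=\sum_n n^k p_{m,n}$, and $\mathcal P_k(x)=\sum_m p_m^{(k)}x^m$ the $k$-th area moment generating function. Assume that for every $k\in\mathbb N_0$ $$p_m^{(k)}\sim A_k\,x_c^{-m}\,m^{\gamma_k-1}\qquad(m\to\infty)$$ for numbers $A_k>0$, $x_c>0$ and $\gamma_k=(k-\theta)/\phi$, with real $\theta$ and $0<\phi<1$. For $r\ge1$ let $p_{m,n}^{(r)}$ be the number of punctured polygons of the class with $r$ punctures of arbitrary size, half-perimeter $m$ and area $n$, and $p_m^{(r,k)}=\sum_n n^k p_{m,n}^{(r)}$. Then for every $k\in\mathbb N_0$ $$p_m^{(r,k)}\le \frac{[x^m]\,\mathcal P_{k+r}(x)\,(\mathcal P_0(x))^r}{r!}.$$ Moreover, if $\theta>0$, then for every $k\in\mathbb N_0$ $$p_m^{(r,k)}\sim\frac{[x^m]\,\mathcal P_{k+r}(x)\,(\mathcal P_0(x))^r}{r!}\sim A_k^{(r)}\,x_c^{-m}\,m^{\gamma_{k+r}-1}\qquad(m\to\infty),\qquad A_k^{(r)}=\frac{A_{k+r}\,(\mathcal P_0(x_c))^r}{r!},$$ where $\mathcal P_0(x_c):=\lim_{x\nearrow x_c}\mathcal P_0(x)<\infty$.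
   Context: Polygons are considered up to translation. The half-perimeter of a polygon is half its number of edges and its area is the number of unit cells it encloses. A punctured polygon of the class with $r$ punctures consists of an outer polygon from $\mathcal C$ and an unordered collection of $r$ polygons from $\mathcal C$ (the punctures/holes) lying inside the outer polygon, such that the boundary curves of all these $r+1$ polygons are pairwise disjoint. Its half-perimeter is the sum of the half-perimeters of the outer polygon and all holes; its area is the area of the outer polygon minus the areas of the holes. $[x^m]G(x)$ denotes the coefficient of $x^m$ in the power series $G$. *)

theory Defs
  imports "HOL-Analysis.Analysis" "HOL-Library.Landau_Symbols"
begin

type_synonym vertex = "int \<times> int"

type_synonym polygon = "vertex set set" \<comment> \<open>a set of edges, each edge being its set of endpoints\<close>

definition adjacent :: "vertex \<Rightarrow> vertex \<Rightarrow> bool" where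
  "adjacent u v \<longleftrightarrow> \<bar>fst u - fst v\<bar> + \<bar>snd u - snd v\<bar> = 1"

text \<open>A self-avoiding polygon is the edge set of a cycle in the square lattice. It carries neither
  a starting point nor an orientation. Length two is excluded, since there the closed walk would
  traverse a single edge twice.\<close>

definition self_avoiding_polygon :: "polygon \<Rightarrow> bool" where
  "self_avoiding_polygon P \<longleftrightarrow>
     (\<exists>vs. 3 \<le> length vs \<and> distinct vs \<and>
        (\<forall>i<length vs. adjacent (vs ! i) (vs ! (Suc i mod length vs))) \<and>
        P = {{vs ! i, vs ! (Suc i mod length vs)} | i. i < length vs})"

text \<open>The division is exact: the square lattice is bipartite, so polygons have evenly many edges.\<close>

definition half_perimeter :: "polygon \<Rightarrow> nat" where
  "half_perimeter P = card P div 2"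

definition point :: "vertex \<Rightarrow> complex" where
  "point v = Complex (of_int (fst v)) (of_int (snd v))"

definition curve :: "polygon \<Rightarrow> complex set" where
  "curve P = (\<Union>e\<in>P. convex hull (point ` e))"

text \<open>Unit cells are named by their lower left corner.\<close>

definition cell :: "vertex \<Rightarrow> complex set" where
  "cell v = box (point v) (point (v + (1, 1)))"

definition area :: "polygon \<Rightarrow> nat" where
  "area P = card {v. cell v \<subseteq> inside (curve P)}"

definition translate :: "vertex \<Rightarrow> polygon \<Rightarrow> polygon" where
  "translate v P = (\<lambda>e. (\<lambda>u. v + u) ` e) ` P"

text \<open>Polygons are considered up to translation. A class is represented by the set of all
  placements of its polygons in the lattice, and counting is done modulo translation.\<close>

definition polygon_class :: "polygon set \<Rightarrow> bool" where
  "polygon_class C \<longleftrightarrow> (\<forall>P\<in>C. self_avoiding_polygon P \<and> (\<forall>v. translate v P \<in> C))"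

definition translation_rel :: "(polygon \<times> polygon) set" where
  "translation_rel = {(P, Q). \<exists>v. Q = translate v P}"

definition num_polygons :: "polygon set \<Rightarrow> nat \<Rightarrow> nat \<Rightarrow> nat" where
  "num_polygons C m n =
     card ({P \<in> C. half_perimeter P = m \<and> area P = n} // translation_rel)"

definition area_moment :: "polygon set \<Rightarrow> nat \<Rightarrow> nat \<Rightarrow> real" where
  "area_moment C k m = (\<Sum>n. real n ^ k * real (num_polygons C m n))"

definition moment_gf :: "polygon set \<Rightarrow> nat \<Rightarrow> real fps" where
  "moment_gf C k = Abs_fps (\<lambda>m. area_moment C k m)"

text \<open>A punctured polygon is a pair of an outer polygon and a set of holes. Repeated holes need not
  be considered, because the boundary curves are pairwise disjoint. Outer polygon and holes are
  translated jointly.\<close>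

type_synonym punctured_polygon = "polygon \<times> polygon set"

definition punctured_polygons :: "polygon set \<Rightarrow> nat \<Rightarrow> punctured_polygon set" where
  "punctured_polygons C r =
     {(P, H). P \<in> C \<and> H \<subseteq> C \<and> finite H \<and> card H = r \<and>
        (\<forall>Q\<in>H. curve Q \<subseteq> inside (curve P)) \<and> disjoint_family_on curve (insert P H)}"

definition punctured_half_perimeter :: "punctured_polygon \<Rightarrow> nat" where
  "punctured_half_perimeter X = half_perimeter (fst X) + (\<Sum>Q\<in>snd X. half_perimeter Q)"

text \<open>The area is an integer, as disjointness of the boundary curves does not prevent a hole from
  surrounding another one.\<close>

definition punctured_area :: "punctured_polygon \<Rightarrow> int" where
  "punctured_area X = int (area (fst X)) - (\<Sum>Q\<in>snd X. int (area Q))"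

definition punctured_translation_rel :: "(punctured_polygon \<times> punctured_polygon) set" where
  "punctured_translation_rel =
     {(X, Y). \<exists>v. Y = (translate v (fst X), translate v ` snd X)}"

definition num_punctured :: "polygon set \<Rightarrow> nat \<Rightarrow> nat \<Rightarrow> nat \<Rightarrow> nat" where
  "num_punctured C r m n =
     card ({X \<in> punctured_polygons C r. punctured_half_perimeter X = m \<and> punctured_area X = int n}
       // punctured_translation_rel)"

definition punctured_moment :: "polygon set \<Rightarrow> nat \<Rightarrow> nat \<Rightarrow> nat \<Rightarrow> real" where
  "punctured_moment C r k m = (\<Sum>n. real n ^ k * real (num_punctured C r m n))"

end

theory Submission
  imports Defs "HOL-Combinatorics.Multiset_Permutations"
begin

text \<open>A hole lying inside the outer polygon is determined, up to translation, by its shape and by the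
  cell at its anchor vertex, which is enclosed by the outer polygon. Hence an outer polygon of area
  \<open>n\<close> admits at most \<open>n ^ r\<close> placements of \<open>r\<close> given labelled holes, which is the upper bound.
  If the half-perimeters of the holes are bounded by \<open>s\<close>, all but \<open>O(m n ^ (r - 1))\<close> of the \<open>n ^ r\<close>
  placements are admissible, where \<open>m\<close> is the half-perimeter of the outer polygon. This error is
  negligible because \<open>1 / \<phi> > 1\<close>. Since \<open>\<gamma> 0 < 0\<close> for \<open>\<theta> > 0\<close>, the coefficients of the moment
  generating function of order zero are summable at \<open>x\<^sub>c\<close>, so convolution with it only multiplies the
  leading asymptotics by its value there. Letting \<open>s \<rightarrow> \<infinity>\<close> closes the gap.\<close>

section \<open>Translations\<close>

text \<open>The count of admissible positions is not uniform in the size of the holes: a hole about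
  as large as the outer polygon leaves hardly any choice. Therefore the cutoff \<open>s\<close> is
  fixed before the total half-perimeter tends to infinity. With bounded holes there are three
  losses, namely positions near the boundary, positions near other holes, and the area removed by
  the holes; together they are O(m). Bernoulli's inequality turns them into a deficit O(m n^(k + r -
  1)) against n^(k + r). Summed over all outer polygons, and up to the common exponential factor,
  the deficit has order \<open>m powr \<gamma> (k + r - 1)\<close>, while the main term has order
  \<open>m powr (\<gamma> (k + r) - 1)\<close>. Their quotient is of order
  \<open>m powr (1 - 1 / \<phi>)\<close>.\<close>

lemma point_add: "point (u + v) = point u + point v"
  by (simp add: point_def complex_eq_iff)

text \<open>Connected components of the complement move along with the set. The inclusion
  \<open>sub\<close> is proved for every shift, and its instance at \<open>- a\<close> yields the
  reverse inclusion.\<close>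

lemma inside_translation:
  fixes S :: "'a :: real_normed_vector set"
  shows "inside ((+) a ` S) = (+) a ` inside S"
proof -
  have comp: "connected_component_set (- ((+) a ` S)) (a + x)
      \<subseteq> (+) a ` connected_component_set (- S) x" for a x and S :: "'a set"
  proof
    fix y assume "y \<in> connected_component_set (- ((+) a ` S)) (a + x)"
    then obtain T where T: "connected T" "T \<subseteq> - ((+) a ` S)" "a + x \<in> T" "y \<in> T"
      by (auto simp: connected_component_def)
    have "connected_component (- S) x (y - a)"
      unfolding connected_component_def
    proof (intro exI conjI)
      show "connected ((\<lambda>z. z - a) ` T)"
        using T(1) by (intro connected_continuous_image continuous_intros)
      show "(\<lambda>z. z - a) ` T \<subseteq> - S" using T(2) by force
      show "x \<in> (\<lambda>z. z - a) ` T" using T(3) by force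
    qed (use T in auto)
    then show "y \<in> (+) a ` connected_component_set (- S) x" by force
  qed
  have sub: "(+) a ` inside S \<subseteq> inside ((+) a ` S)" for a and S :: "'a set"
  proof
    fix y assume "y \<in> (+) a ` inside S"
    then obtain x where x: "y = a + x" "x \<notin> S" "bounded (connected_component_set (- S) x)"
      by (auto simp: inside_def)
    then show "y \<in> inside ((+) a ` S)"
      using bounded_subset[OF bounded_translation[OF x(3), of a] comp] by (auto simp: inside_def)
  qed
  have "inside ((+) a ` S) = (+) a ` (+) (- a) ` inside ((+) a ` S)"
    by (simp add: image_image)
  also have "\<dots> \<subseteq> (+) a ` inside ((+) (- a) ` (+) a ` S)"
    using sub by blast
  also have "(+) (- a) ` (+) a ` S = S"
    by (simp add: image_image)
  finally show ?thesis using sub by blast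
qed

lemma mem_translation_iff:
  fixes a :: "'a :: ab_group_add"
  shows "y \<in> (+) a ` S \<longleftrightarrow> y - a \<in> S"
proof
  assume "y - a \<in> S"
  then have "a + (y - a) \<in> (+) a ` S" by (rule imageI)
  then show "y \<in> (+) a ` S" by simp
qed auto

lemma curve_translate: "curve (translate v P) = (+) (point v) ` curve P"
proof -
  have "convex hull (point ` (+) v ` e) = (+) (point v) ` (convex hull (point ` e))" for e
    by (simp add: image_image point_add flip: convex_hull_translation)
  then show ?thesis
    unfolding curve_def translate_def by (auto simp: image_UN)
qed

lemma cell_translate: "cell (v + u) = (+) (point v) ` cell u"
  by (auto simp: set_eq_iff mem_translation_iff cell_def in_box_complex_iff point_def)

lemma translate_0 [simp]: "translate 0 P = P"
  by (simp add: translate_def)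

lemma translate_add: "translate (u + v) P = translate u (translate v P)"
  by (simp add: translate_def image_image add.assoc)

lemma Union_translate: "\<Union> (translate v P) = (+) v ` \<Union>P"
  by (auto simp: translate_def)

lemma inj_translate: "inj (translate v)"
  by (rule inj_on_inverseI[of _ "translate (- v)"]) (simp flip: translate_add)

lemma card_translate [simp]: "card (translate v P) = card P"
proof -
  have "inj ((`) ((+) v))" by (rule inj_on_inverseI[of _ "(`) ((+) (- v))"]) (simp add: image_image)
  then show ?thesis unfolding translate_def by (rule card_image[OF inj_on_subset[OF _ subset_UNIV]])
qed

lemma half_perimeter_translate [simp]: "half_perimeter (translate v P) = half_perimeter P"
  by (simp add: half_perimeter_def)

definition interior_cells :: "polygon \<Rightarrow> vertex set" where
  "interior_cells P = {v. cell v \<subseteq> inside (curve P)}"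

lemma area_eq: "area P = card (interior_cells P)"
  by (simp add: area_def interior_cells_def)

lemma area_translate [simp]: "area (translate v P) = area P"
proof -
  have *: "cell (v + u) \<subseteq> inside (curve (translate v P)) \<longleftrightarrow> cell u \<subseteq> inside (curve P)" for u
    unfolding cell_translate curve_translate inside_translation by (rule inj_image_subset_iff) simp
  have "u \<in> interior_cells (translate v P) \<longleftrightarrow> u - v \<in> interior_cells P" for u
    using *[of "u - v"] by (simp add: interior_cells_def)
  then have "interior_cells (translate v P) = (+) v ` interior_cells P"
    unfolding set_eq_iff mem_translation_iff by blast
  then show ?thesis by (simp add: area_eq card_image)
qed

section \<open>Lattice squares\<close>

text \<open>Closed ball of radius \<open>l\<close> in the maximum norm around \<open>v\<close>;
  \<open>solid_square\<close> is its counterpart in the plane.\<close>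

definition lattice_square :: "vertex \<Rightarrow> int \<Rightarrow> vertex set" where
  "lattice_square v l = {fst v - l..fst v + l} \<times> {snd v - l..snd v + l}"

definition solid_square :: "vertex \<Rightarrow> int \<Rightarrow> complex set" where
  "solid_square v l = cbox (point v - Complex (of_int l) (of_int l)) (point v + Complex (of_int l) (of_int l))"

lemma finite_lattice_square [simp]: "finite (lattice_square v l)"
  by (simp add: lattice_square_def)

lemma card_lattice_square: "l \<ge> 0 \<Longrightarrow> card (lattice_square v l) = nat (2 * l + 1) ^ 2"
  by (simp add: lattice_square_def card_cartesian_product power2_eq_square algebra_simps)

lemma mem_lattice_square:
  "u \<in> lattice_square v l \<longleftrightarrow> \<bar>fst u - fst v\<bar> \<le> l \<and> \<bar>snd u - snd v\<bar> \<le> l"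
  by (cases u) (auto simp: lattice_square_def)

lemma mem_solid_square:
  "z \<in> solid_square v l \<longleftrightarrow> \<bar>Re z - of_int (fst v)\<bar> \<le> of_int l \<and> \<bar>Im z - of_int (snd v)\<bar> \<le> of_int l"
  by (auto simp: solid_square_def in_cbox_complex_iff point_def)

lemma point_mem_solid_square: "point u \<in> solid_square v l \<longleftrightarrow> u \<in> lattice_square v l"
  unfolding mem_solid_square mem_lattice_square by (simp add: point_def flip: of_int_diff of_int_abs)

lemma convex_solid_square: "convex (solid_square v l)"
  by (simp add: solid_square_def)

lemma mem_cell:
  "z \<in> cell v \<longleftrightarrow> of_int (fst v) < Re z \<and> Re z < of_int (fst v) + 1 \<and>
     of_int (snd v) < Im z \<and> Im z < of_int (snd v) + 1"
  by (auto simp: cell_def in_box_complex_iff point_def)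

lemma curve_subset_solid_square:
  assumes "\<Union>P \<subseteq> lattice_square v l"
  shows "curve P \<subseteq> solid_square v l"
  unfolding curve_def
proof (intro UN_least hull_minimal)
  fix e assume "e \<in> P"
  then show "point ` e \<subseteq> solid_square v l"
    using assms by (auto simp: point_mem_solid_square)
qed (rule convex_solid_square)

section \<open>Self-avoiding polygons\<close>

lemma sap_edge:
  assumes "self_avoiding_polygon P" "e \<in> P"
  obtains u v where "e = {u, v}" "adjacent u v"
proof -
  from assms obtain vs i where "e = {vs ! i, vs ! (Suc i mod length vs)}"
      "adjacent (vs ! i) (vs ! (Suc i mod length vs))"
    unfolding self_avoiding_polygon_def by blast
  then show ?thesis using that by blast
qed

lemma sap_vertices:
  assumes "self_avoiding_polygon P"
  obtains vs where "3 \<le> length vs" "distinct vs" "\<Union>P = set vs"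
    "\<forall>i. Suc i < length vs \<longrightarrow> adjacent (vs ! i) (vs ! Suc i)" "finite P"
proof -
  from assms obtain vs where vs: "3 \<le> length vs" "distinct vs"
      "\<And>i. i < length vs \<Longrightarrow> adjacent (vs ! i) (vs ! (Suc i mod length vs))"
      and P: "P = (\<lambda>i. {vs ! i, vs ! (Suc i mod length vs)}) ` {..<length vs}"
    unfolding self_avoiding_polygon_def by (auto simp: setcompr_eq_image lessThan_def)
  have "Suc i mod length vs < length vs" for i
    using vs(1) by (intro mod_less_divisor) linarith
  then have "\<Union>P \<subseteq> set vs"
    unfolding P by (intro Union_least) (elim imageE, simp)
  moreover have "set vs \<subseteq> \<Union>P"
  proof
    fix u assume "u \<in> set vs"
    then obtain i where "i < length vs" "u = vs ! i" by (metis in_set_conv_nth)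
    then show "u \<in> \<Union>P" unfolding P by blast
  qed
  ultimately have "\<Union>P = set vs" by blast
  moreover have "\<forall>i. Suc i < length vs \<longrightarrow> adjacent (vs ! i) (vs ! Suc i)"
  proof (intro allI impI)
    fix i assume "Suc i < length vs"
    with vs(3)[of i] show "adjacent (vs ! i) (vs ! Suc i)" by simp
  qed
  moreover have "finite P" unfolding P by simp
  ultimately show ?thesis using vs(1,2) by (intro that[of vs])
qed

lemma sap_finite: "self_avoiding_polygon P \<Longrightarrow> finite P"
  by (erule sap_vertices)

lemma sap_finite_vertices: "self_avoiding_polygon P \<Longrightarrow> finite (\<Union>P)"
  by (erule sap_vertices) simp

lemma sap_vertices_nonempty: "self_avoiding_polygon P \<Longrightarrow> \<Union>P \<noteq> {}"
  by (erule sap_vertices) auto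

text \<open>Counting both endpoints of every edge gives the crude factor 2, which only enlarges
  later constants.\<close>

lemma sap_card_vertices:
  assumes "self_avoiding_polygon P"
  shows "card (\<Union>P) \<le> 2 * card P"
proof -
  have "card (\<Union>P) \<le> (\<Sum>e\<in>P. card e)" by (rule card_Union_le_sum_card)
  also have "\<dots> \<le> (\<Sum>e\<in>P. 2)"
    by (rule sum_mono) (use assms in \<open>auto elim!: sap_edge simp: card_insert_if\<close>)
  finally show ?thesis by simp
qed

lemma card_le_half_perimeter: "card P \<le> 2 * half_perimeter P + 1"
  by (simp add: half_perimeter_def)

text \<open>Along the cycle, the vertex of index \<open>i\<close> is within distance
  \<open>i\<close> of the vertex of index 0, and there are at most
  \<open>4 * half_perimeter P + 2\<close> vertices. Comparing both \<open>u\<close> and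
  \<open>w\<close> with index 0 doubles this number.\<close>

lemma sap_vertices_bound:
  assumes P: "self_avoiding_polygon P" and u: "u \<in> \<Union>P"
  shows "\<Union>P \<subseteq> lattice_square u (8 * int (half_perimeter P) + 4)"
proof
  fix w assume w: "w \<in> \<Union>P"
  obtain vs where "3 \<le> length vs" and vs: "distinct vs" "\<Union>P = set vs"
      "\<forall>i. Suc i < length vs \<longrightarrow> adjacent (vs ! i) (vs ! Suc i)" and "finite P"
    using sap_vertices[OF P] .
  have dist: "\<bar>fst (vs ! i) - fst (vs ! 0)\<bar> \<le> int i \<and> \<bar>snd (vs ! i) - snd (vs ! 0)\<bar> \<le> int i"
    if "i < length vs" for i
    using that
  proof (induction i)
    case (Suc i)
    then show ?case using vs(3) by (force simp: adjacent_def)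
  qed simp
  have "length vs \<le> 2 * card P"
    using sap_card_vertices[OF P] vs(1,2) by (simp add: distinct_card)
  then have len: "length vs \<le> 4 * half_perimeter P + 2"
    using card_le_half_perimeter[of P] by simp
  obtain i j where "i < length vs" "w = vs ! i" "j < length vs" "u = vs ! j"
    using u w vs(2) by (metis in_set_conv_nth)
  with dist[of i] dist[of j] len show "w \<in> lattice_square u (8 * int (half_perimeter P) + 4)"
    by (auto simp: mem_lattice_square)
qed

lemma sap_compact_curve: "self_avoiding_polygon P \<Longrightarrow> compact (curve P)"
  unfolding curve_def
proof (rule compact_UN)
  assume P: "self_avoiding_polygon P"
  then show "finite P" by (rule sap_finite)
  fix e assume "e \<in> P"
  with P obtain u v where "e = {u, v}" by (rule sap_edge)
  then show "compact (convex hull (point ` e))"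
    by (simp add: finite_imp_compact_convex_hull)
qed

lemma point_mem_curve: "u \<in> \<Union>P \<Longrightarrow> point u \<in> curve P"
  unfolding curve_def by (auto intro!: hull_inc)

lemma curve_near_vertex:
  assumes "self_avoiding_polygon P" "z \<in> curve P"
  obtains u where "u \<in> \<Union>P" "z \<in> solid_square u 1"
proof -
  obtain e where e: "e \<in> P" "z \<in> convex hull (point ` e)" using assms(2) by (auto simp: curve_def)
  obtain u v where uv: "e = {u, v}" "adjacent u v" using sap_edge[OF assms(1) e(1)] .
  have "convex hull (point ` e) \<subseteq> solid_square u 1"
    using uv by (intro hull_minimal convex_solid_square)
      (auto simp: point_mem_solid_square mem_lattice_square adjacent_def)
  with e uv that show ?thesis by blast
qed

text \<open>Every edge lies on a line with one integer coordinate, whereas in an open unit cell both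
  coordinates lie strictly between consecutive integers.\<close>

lemma cell_disjoint_curve:
  assumes "self_avoiding_polygon P"
  shows "cell v \<inter> curve P = {}"
proof (rule ccontr)
  assume "cell v \<inter> curve P \<noteq> {}"
  then obtain z e where z: "z \<in> cell v" "e \<in> P" "z \<in> convex hull (point ` e)"
    by (auto simp: curve_def)
  obtain u w where e: "e = {u, w}" "adjacent u w" using sap_edge[OF assms z(2)] .
  then consider "fst u = fst w" | "snd u = snd w" unfolding adjacent_def by linarith
  then show False
  proof cases
    case 1
    have "convex hull (point ` e) \<subseteq> {z. Re z = of_int (fst u)}"
      using e 1 by (intro hull_minimal) (auto simp: point_def convex_def algebra_simps simp flip: distrib_right)
    then have "Re z = of_int (fst u)" using z(3) by auto
    with z(1) have "of_int (fst v) < (of_int (fst u) :: real)" "(of_int (fst u) :: real) < of_int (fst v + 1)"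
      by (auto simp: mem_cell)
    then show False unfolding of_int_less_iff by simp
  next
    case 2
    have "convex hull (point ` e) \<subseteq> {z. Im z = of_int (snd u)}"
      using e 2 by (intro hull_minimal) (auto simp: point_def convex_def algebra_simps simp flip: distrib_right)
    then have "Im z = of_int (snd u)" using z(3) by auto
    with z(1) have "of_int (snd v) < (of_int (snd u) :: real)" "(of_int (snd u) :: real) < of_int (snd v + 1)"
      by (auto simp: mem_cell)
    then show False unfolding of_int_less_iff by simp
  qed
qed

section \<open>Cells and squares inside a polygon\<close>

lemma connected_subset_inside:
  assumes "connected T" "T \<inter> S = {}" "T \<inter> inside S \<noteq> {}"
  shows "T \<subseteq> inside S"
proof
  fix y assume y: "y \<in> T"
  obtain x where x: "x \<in> T" "x \<in> inside S" using assms(3) by blast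
  have "connected_component (- S) x y"
    unfolding connected_component_def using assms(1,2) x(1) y by blast
  then show "y \<in> inside S" using inside_same_component x(2) by blast
qed

lemma connected_cell: "connected (cell v)"
  by (simp add: cell_def convex_connected)

lemma cell_nonempty: "cell v \<noteq> {}"
proof -
  have "point v + Complex (1/2) (1/2) \<in> cell v" by (simp add: mem_cell point_def)
  then show ?thesis by blast
qed

lemma point_closure_cell: "point v \<in> closure (cell v)"
  using cell_nonempty[of v] unfolding cell_def
  by (subst closure_box) (auto simp: in_cbox_complex_iff point_def)

text \<open>The vertex is a corner of its cell and the inside is open, so the cell meets the inside;
  as it avoids the curve, it stays in one component of the complement. This converts the position of
  a hole into a cell counted by \<open>area\<close>.\<close>

lemma interior_cell_of_inside_point:
  assumes "self_avoiding_polygon P" "point v \<in> inside (curve P)"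
  shows "v \<in> interior_cells P"
proof -
  have "open (inside (curve P))"
    using assms(1) by (intro open_inside compact_imp_closed sap_compact_curve)
  then have "inside (curve P) \<inter> cell v \<noteq> {}"
    using assms(2) point_closure_cell[of v] open_Int_closure_eq_empty by blast
  then have "cell v \<subseteq> inside (curve P)"
    using cell_disjoint_curve[OF assms(1)] connected_cell by (intro connected_subset_inside) auto
  then show ?thesis by (simp add: interior_cells_def)
qed

lemma finite_interior_cells:
  assumes "self_avoiding_polygon P"
  shows "finite (interior_cells P)"
proof -
  have "bounded (inside (curve P))"
    using assms by (intro bounded_inside compact_imp_bounded sap_compact_curve)
  then obtain b where b: "\<And>z. z \<in> inside (curve P) \<Longrightarrow> norm z \<le> b"
    by (auto simp: bounded_iff)
  have "interior_cells P \<subseteq> lattice_square 0 (\<lceil>b\<rceil> + 1)"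
  proof
    fix v assume "v \<in> interior_cells P"
    \<comment> \<open>The centre stands for the cell; its offset of 1/2 is absorbed by the slack 1
      in the radius.\<close>
    moreover have "point v + Complex (1/2) (1/2) \<in> cell v" by (simp add: mem_cell point_def)
    ultimately have "norm (point v + Complex (1/2) (1/2)) \<le> b" by (auto simp: interior_cells_def intro: b)
    moreover have "\<bar>of_int (fst v) + 1/2\<bar> \<le> norm (point v + Complex (1/2) (1/2))"
      using abs_Re_le_cmod[of "point v + Complex (1/2) (1/2)"] by (simp add: point_def)
    moreover have "\<bar>of_int (snd v) + 1/2\<bar> \<le> norm (point v + Complex (1/2) (1/2))"
      using abs_Im_le_cmod[of "point v + Complex (1/2) (1/2)"] by (simp add: point_def)
    ultimately have "\<bar>of_int (fst v)\<bar> \<le> b + 1" "\<bar>of_int (snd v)\<bar> \<le> b + 1" by linarith+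
    then show "v \<in> lattice_square 0 (\<lceil>b\<rceil> + 1)"
      by (simp add: mem_lattice_square) linarith
  qed
  then show ?thesis by (rule finite_subset) simp
qed

text \<open>A curve point is within maximum-norm distance 1 of some vertex, so \<open>v\<close> lies
  within \<open>l + 1\<close> of a vertex. There are at most \<open>2 * card P\<close> vertices, and
  a square of radius \<open>l + 1\<close> has \<open>2 * l + 3\<close> lattice points per
  side.\<close>

lemma card_cells_near_curve:
  assumes P: "self_avoiding_polygon P" and l: "l \<ge> 0"
  shows "card {v. solid_square v l \<inter> curve P \<noteq> {}} \<le> 2 * card P * nat (2 * l + 3) ^ 2"
    and "finite {v. solid_square v l \<inter> curve P \<noteq> {}}"
proof -
  have sub: "{v. solid_square v l \<inter> curve P \<noteq> {}} \<subseteq> (\<Union>u\<in>\<Union>P. lattice_square u (l + 1))"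
  proof
    fix v assume "v \<in> {v. solid_square v l \<inter> curve P \<noteq> {}}"
    then obtain z where z: "z \<in> solid_square v l" "z \<in> curve P" by blast
    obtain u where u: "u \<in> \<Union>P" "z \<in> solid_square u 1" using curve_near_vertex[OF P z(2)] .
    have "\<bar>real_of_int (fst v - fst u)\<bar> \<le> of_int (l + 1)" "\<bar>real_of_int (snd v - snd u)\<bar> \<le> of_int (l + 1)"
      using z(1) u(2) unfolding mem_solid_square by auto
    then have "v \<in> lattice_square u (l + 1)"
      unfolding mem_lattice_square by linarith
    with u show "v \<in> (\<Union>u\<in>\<Union>P. lattice_square u (l + 1))" by blast
  qed
  have fin: "finite (\<Union>u\<in>\<Union>P. lattice_square u (l + 1))"
    by (rule finite_UN_I[OF sap_finite_vertices[OF P]]) simp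
  show "finite {v. solid_square v l \<inter> curve P \<noteq> {}}" using sub fin by (rule finite_subset)
  have "card {v. solid_square v l \<inter> curve P \<noteq> {}} \<le> card (\<Union>u\<in>\<Union>P. lattice_square u (l + 1))"
    using fin sub by (rule card_mono)
  also have "\<dots> \<le> (\<Sum>u\<in>\<Union>P. card (lattice_square u (l + 1)))"
    using sap_finite_vertices[OF P] by (rule card_UN_le)
  also have "\<dots> = card (\<Union>P) * nat (2 * l + 3) ^ 2"
    using l by (simp add: card_lattice_square algebra_simps)
  also have "\<dots> \<le> 2 * card P * nat (2 * l + 3) ^ 2"
    using sap_card_vertices[OF P] by (intro mult_right_mono) auto
  finally show "card {v. solid_square v l \<inter> curve P \<noteq> {}} \<le> 2 * card P * nat (2 * l + 3) ^ 2" .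
qed

text \<open>For \<open>l \<ge> 1\<close> the square contains the cell of \<open>v\<close>, so it
  meets the inside; being connected and off the curve, it cannot leave it.\<close>

lemma solid_square_subset_inside:
  assumes "v \<in> interior_cells P" "solid_square v l \<inter> curve P = {}" "l \<ge> 1"
  shows "solid_square v l \<subseteq> inside (curve P)"
proof (rule connected_subset_inside)
  have l: "real_of_int l \<ge> 1" using assms(3) by simp
  have "cell v \<subseteq> solid_square v l"
    using l by (auto simp: mem_cell mem_solid_square)
  then show "solid_square v l \<inter> inside (curve P) \<noteq> {}"
    using assms(1) cell_nonempty[of v] by (auto simp: interior_cells_def)
qed (use assms convex_connected[OF convex_solid_square] in auto)

lemma solid_squares_disjoint:
  assumes "u \<notin> lattice_square v (2 * l)"
  shows "solid_square u l \<inter> solid_square v l = {}"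
proof (rule ccontr)
  assume "solid_square u l \<inter> solid_square v l \<noteq> {}"
  then obtain z where "z \<in> solid_square u l" "z \<in> solid_square v l" by blast
  then have "\<bar>real_of_int (fst u - fst v)\<bar> \<le> of_int (2 * l)" "\<bar>real_of_int (snd u - snd v)\<bar> \<le> of_int (2 * l)"
    unfolding mem_solid_square by auto
  then have "u \<in> lattice_square v (2 * l)"
    unfolding mem_lattice_square by linarith
  with assms show False by simp
qed

section \<open>Counting modulo translation\<close>

text \<open>The lexicographically least vertex. It commutes with translation, so requiring it to be
  the origin selects one placement from every translation class.\<close>

definition anchor :: "polygon \<Rightarrow> vertex" where
  "anchor P = (let a = Min (fst ` \<Union>P) in (a, Min {b. (a, b) \<in> \<Union>P}))"

lemma anchor_mem:
  assumes "finite (\<Union>P)" "\<Union>P \<noteq> {}"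
  shows "anchor P \<in> \<Union>P"
proof -
  define a where "a = Min (fst ` \<Union>P)"
  have "a \<in> fst ` \<Union>P" unfolding a_def by (rule Min_in) (use assms in auto)
  then have "{b. (a, b) \<in> \<Union>P} \<noteq> {}" by force
  moreover have "finite {b. (a, b) \<in> \<Union>P}"
    by (rule finite_subset[of _ "snd ` \<Union>P"]) (use assms(1) in force)+
  ultimately have "Min {b. (a, b) \<in> \<Union>P} \<in> {b. (a, b) \<in> \<Union>P}" by (intro Min_in)
  then show ?thesis by (simp add: anchor_def a_def Let_def)
qed

lemma anchor_translate:
  assumes "finite (\<Union>P)" "\<Union>P \<noteq> {}"
  shows "anchor (translate v P) = v + anchor P"
proof -
  define a where "a = Min (fst ` \<Union>P)"
  have fst_eq: "Min (fst ` \<Union>(translate v P)) = fst v + a"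
  proof -
    have "fst ` \<Union>(translate v P) = (+) (fst v) ` fst ` \<Union>P"
      by (simp add: Union_translate image_image)
    also have "Min \<dots> = fst v + a"
      unfolding a_def by (rule mono_Min_commute[symmetric]) (use assms in \<open>auto simp: mono_def\<close>)
    finally show ?thesis .
  qed
  have "a \<in> fst ` \<Union>P" unfolding a_def by (rule Min_in) (use assms in auto)
  then have ne: "{b. (a, b) \<in> \<Union>P} \<noteq> {}" by force
  have fin: "finite {b. (a, b) \<in> \<Union>P}"
    by (rule finite_subset[of _ "snd ` \<Union>P"]) (use assms(1) in force)+
  have "{b. (fst v + a, b) \<in> \<Union>(translate v P)} = (+) (snd v) ` {b. (a, b) \<in> \<Union>P}"
    unfolding Union_translate by (cases v) (force simp: image_iff)
  also have "Min \<dots> = snd v + Min {b. (a, b) \<in> \<Union>P}"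
    by (rule mono_Min_commute[symmetric]) (use ne fin in \<open>auto simp: mono_def\<close>)
  finally show ?thesis
    unfolding anchor_def fst_eq Let_def a_def[symmetric] by (cases v) simp
qed

lemma sap_anchor_mem: "self_avoiding_polygon P \<Longrightarrow> anchor P \<in> \<Union>P"
  by (intro anchor_mem sap_finite_vertices sap_vertices_nonempty)

lemma sap_anchor_translate: "self_avoiding_polygon P \<Longrightarrow> anchor (translate v P) = v + anchor P"
  by (intro anchor_translate sap_finite_vertices sap_vertices_nonempty)

text \<open>A function that shifts along with the action has exactly one zero in each orbit:
  \<open>act (- f x) x\<close> is one, and two zeros in the same orbit differ by the shift
  0.\<close>

lemma card_quotient_by_action:
  fixes act :: "'g :: ab_group_add \<Rightarrow> 'x \<Rightarrow> 'x" and X :: "'x set"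
  assumes act: "\<And>x. act 0 x = x" "\<And>u v x. act (u + v) x = act u (act v x)"
    and X: "\<And>v x. x \<in> X \<Longrightarrow> act v x \<in> X"
    and f: "\<And>v x. x \<in> X \<Longrightarrow> f (act v x) = v + f x"
  shows "card (X // {(x, y). \<exists>v. y = act v x}) = card {x \<in> X. f x = 0}"
proof -
  let ?R = "{(x, y). \<exists>v. y = act v x}"
  have orbit: "?R `` {act v x} = ?R `` {x}" for v x
  proof -
    have "act w x = act (w - v) (act v x)" for w by (simp flip: act(2))
    moreover have "act w (act v x) = act (w + v) x" for w by (rule act(2)[symmetric])
    ultimately show ?thesis by blast
  qed
  have "bij_betw (\<lambda>x. ?R `` {x}) {x \<in> X. f x = 0} (X // ?R)"
  proof (rule bij_betw_imageI)
    show "inj_on (\<lambda>x. ?R `` {x}) {x \<in> X. f x = 0}"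
    proof (rule inj_onI)
      fix x y assume x: "x \<in> {x \<in> X. f x = 0}" and y: "y \<in> {x \<in> X. f x = 0}"
        and eq: "?R `` {x} = ?R `` {y}"
      have "y \<in> ?R `` {y}" using act(1)[of y] by (auto intro: exI[of _ 0])
      then obtain v where "y = act v x" using eq by auto
      with x y f[of x v] act(1) show "x = y" by simp
    qed
    have "?R `` {x} \<in> (\<lambda>x. ?R `` {x}) ` {x \<in> X. f x = 0}" if "x \<in> X" for x
    proof (rule image_eqI)
      show "?R `` {x} = ?R `` {act (- f x) x}" by (rule orbit[symmetric])
      show "act (- f x) x \<in> {x \<in> X. f x = 0}" using that X f by simp
    qed
    then show "(\<lambda>x. ?R `` {x}) ` {x \<in> X. f x = 0} = X // ?R"
      by (auto simp: quotient_def)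
  qed
  then show ?thesis by (rule bij_betw_same_card[symmetric])
qed

section \<open>Convolution asymptotics\<close>

text \<open>Dominated convergence for series.\<close>

lemma tannery_sequence:
  fixes f :: "nat \<Rightarrow> nat \<Rightarrow> real"
  assumes "\<And>k. (\<lambda>n. f k n) \<longlonglongrightarrow> l k" "\<And>k n. \<bar>f k n\<bar> \<le> M k" "summable M"
  shows "(\<lambda>n. \<Sum>k. f k n) \<longlonglongrightarrow> (\<Sum>k. l k)"
proof -
  have "eventually (\<lambda>(k,n). norm (f k n) \<le> M k) (at_top \<times>\<^sub>F sequentially)"
    by (rule always_eventually) (use assms(2) in auto)
  from tannerys_theorem[OF assms(1) this assms(3)] show ?thesis by simp
qed

lemma summable_Suc_powr:
  assumes "\<beta> < -1"
  shows "summable (\<lambda>m. real (Suc m) powr \<beta>)"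
  using assms summable_real_powr_iff[of \<beta>] summable_Suc_iff[of "\<lambda>m. real m powr \<beta>"] by simp

text \<open>A power is monotone, so its maximum on [1/2, 1] sits at an endpoint. The bound serves
  for the quotients of \<open>Suc (m - j)\<close> by \<open>Suc m\<close> with
  \<open>2 * j \<le> m\<close>, whatever the sign of the exponent.\<close>

lemma powr_le_two_powr_abs:
  fixes t \<delta> :: real
  assumes "1 / 2 \<le> t" "t \<le> 1"
  shows "t powr \<delta> \<le> 2 powr \<bar>\<delta>\<bar>"
proof (cases "\<delta> \<ge> 0")
  case True
  then have "t powr \<delta> \<le> 1" using assms by (intro powr_le1) auto
  also have "1 \<le> (2::real) powr \<bar>\<delta>\<bar>" by (intro ge_one_powr_ge_zero) auto
  finally show ?thesis .
next
  case False
  then have "t powr \<delta> \<le> (1/2) powr \<delta>" using assms by (intro powr_mono2') auto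
  also have "\<dots> = 2 powr \<bar>\<delta>\<bar>" using False by (simp add: powr_divide powr_minus_divide abs_if)
  finally show ?thesis .
qed

text \<open>The convolution is split at half of \<open>m\<close>. Where the index of
  \<open>b\<close> is small, \<open>a\<close> follows its power law at \<open>m\<close>, and the
  summable bound on \<open>b\<close> dominates. Where the index of \<open>a\<close> is small,
  \<open>b (m - i)\<close> is O(m^\<beta>); since \<beta> < \<alpha>, each such term vanishes in the
  limit, so only the sum of \<open>b\<close> survives.\<close>

lemma convolution_limit:
  fixes a b :: "nat \<Rightarrow> real"
  assumes \<beta>: "\<beta> < -1" "\<beta> < \<alpha>"
    and a: "(\<lambda>m. a m / real (Suc m) powr \<alpha>) \<longlonglongrightarrow> A"
    and b: "\<And>m. \<bar>b m\<bar> \<le> B * real (Suc m) powr \<beta>"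
  shows "(\<lambda>m. (\<Sum>i\<le>m. a i * b (m - i)) / real (Suc m) powr \<alpha>) \<longlonglongrightarrow> A * suminf b"
proof -
  obtain K where K: "K > 0" "\<And>m. \<bar>a m / real (Suc m) powr \<alpha>\<bar> \<le> K"
    using convergent_imp_Bseq[OF convergentI[OF a]] unfolding Bseq_def by auto
  have aK: "\<bar>a m\<bar> \<le> K * real (Suc m) powr \<alpha>" for m
    using K(2)[of m] by (simp add: divide_simps split: if_splits)
  have B0: "B \<ge> 0" using b[of 0] by simp
  have sb: "summable (\<lambda>j. B * real (Suc j) powr \<beta>)"
    using summable_Suc_powr[OF \<beta>(1)] by (rule summable_mult)
  \<comment> \<open>Both halves are extended by zero to all indices, which makes them series for
    dominated convergence; the midpoint falls to \<open>g\<close>.\<close>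
  define g where "g j m = (if 2 * j \<le> m then b j * a (m - j) / real (Suc m) powr \<alpha> else 0)" for j m
  define h where "h i m = (if 2 * i < m then a i * b (m - i) / real (Suc m) powr \<alpha> else 0)" for i m
  have eq: "(\<Sum>i\<le>m. a i * b (m - i)) / real (Suc m) powr \<alpha> = (\<Sum>j. g j m) + (\<Sum>i. h i m)" for m
  proof -
    have "(\<Sum>i\<le>m. a i * b (m - i)) =
        (\<Sum>i\<in>{i. i \<le> m \<and> \<not> 2 * i < m}. a i * b (m - i)) + (\<Sum>i\<in>{i. 2 * i < m}. a i * b (m - i))"
      by (subst sum.union_disjoint[symmetric]) (auto intro!: sum.cong finite_subset[of _ "{..m}"])
    also have "(\<Sum>i\<in>{i. i \<le> m \<and> \<not> 2 * i < m}. a i * b (m - i)) = (\<Sum>j\<in>{j. 2 * j \<le> m}. b j * a (m - j))"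
      by (rule sum.reindex_bij_witness[of _ "\<lambda>j. m - j" "\<lambda>j. m - j"]) auto
    finally have *: "(\<Sum>i\<le>m. a i * b (m - i)) =
        (\<Sum>j\<in>{j. 2 * j \<le> m}. b j * a (m - j)) + (\<Sum>i\<in>{i. 2 * i < m}. a i * b (m - i))" .
    have "(\<Sum>j. g j m) = (\<Sum>j\<in>{j. 2 * j \<le> m}. g j m)"
      by (rule suminf_finite) (auto simp: g_def intro: finite_subset[of _ "{..m}"])
    moreover have "(\<Sum>j. h j m) = (\<Sum>j\<in>{j. 2 * j < m}. h j m)"
      by (rule suminf_finite) (auto simp: h_def intro: finite_subset[of _ "{..m}"])
    ultimately show ?thesis
      by (simp add: * add_divide_distrib sum_divide_distrib g_def h_def)
  qed
  have "(\<lambda>m. \<Sum>j. g j m) \<longlonglongrightarrow> (\<Sum>j. b j * A)"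
  proof (rule tannery_sequence)
    fix j
    have shift: "(\<lambda>m. a (m - j) / real (Suc (m - j)) powr \<alpha>) \<longlonglongrightarrow> A"
      using filterlim_compose[OF a filterlim_minus_const_nat_at_top] .
    have "(\<lambda>m. real (Suc (m - j)) / real (Suc m)) \<longlonglongrightarrow> 1"
    proof -
      have "(\<lambda>m. 1 - real j / real (Suc m)) \<longlonglongrightarrow> 1 - 0"
        by (intro tendsto_diff tendsto_const LIMSEQ_Suc lim_const_over_n)
      moreover have "eventually (\<lambda>m. 1 - real j / real (Suc m) = real (Suc (m - j)) / real (Suc m)) sequentially"
        using eventually_ge_at_top[of j] by eventually_elim (auto simp: field_simps of_nat_diff)
      ultimately show ?thesis unfolding diff_zero by (rule Lim_transform_eventually)
    qed
    then have "(\<lambda>m. (real (Suc (m - j)) / real (Suc m)) powr \<alpha>) \<longlonglongrightarrow> 1 powr \<alpha>"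
      by (intro tendsto_powr tendsto_const) auto
    from tendsto_mult[OF tendsto_mult[OF tendsto_const[of "b j"] shift] this]
    have lim: "(\<lambda>m. b j * (a (m - j) / real (Suc (m - j)) powr \<alpha>)
        * (real (Suc (m - j)) / real (Suc m)) powr \<alpha>) \<longlonglongrightarrow> b j * A" by simp
    show "(\<lambda>m. g j m) \<longlonglongrightarrow> b j * A"
    proof (rule Lim_transform_eventually[OF lim])
      show "eventually (\<lambda>m. b j * (a (m - j) / real (Suc (m - j)) powr \<alpha>)
        * (real (Suc (m - j)) / real (Suc m)) powr \<alpha> = g j m) sequentially"
        using eventually_ge_at_top[of "2 * j"]
        by eventually_elim (simp add: g_def powr_divide)
    qed
  next
    fix j m
    show "\<bar>g j m\<bar> \<le> B * real (Suc j) powr \<beta> * (K * 2 powr \<bar>\<alpha>\<bar>)"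
    proof (cases "2 * j \<le> m")
      case True
      have "\<bar>a (m - j) / real (Suc m) powr \<alpha>\<bar> \<le> K * real (Suc (m - j)) powr \<alpha> / real (Suc m) powr \<alpha>"
        using aK[of "m - j"] by (simp add: divide_right_mono)
      also have "\<dots> = K * (real (Suc (m - j)) / real (Suc m)) powr \<alpha>"
        by (simp add: powr_divide)
      also have "\<dots> \<le> K * 2 powr \<bar>\<alpha>\<bar>"
        using True K(1) by (intro mult_left_mono powr_le_two_powr_abs) (auto simp: field_simps of_nat_diff)
      finally have "\<bar>b j\<bar> * \<bar>a (m - j) / real (Suc m) powr \<alpha>\<bar>
          \<le> (B * real (Suc j) powr \<beta>) * (K * 2 powr \<bar>\<alpha>\<bar>)"
        using b[of j] B0 by (intro mult_mono) auto
      then show ?thesis using True by (simp add: g_def abs_mult)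
    next
      case False
      then show ?thesis using B0 K(1) by (simp add: g_def)
    qed
  next
    show "summable (\<lambda>j. B * real (Suc j) powr \<beta> * (K * 2 powr \<bar>\<alpha>\<bar>))"
      using sb by (rule summable_mult2)
  qed
  moreover have "(\<lambda>m. \<Sum>i. h i m) \<longlonglongrightarrow> (\<Sum>i. 0)"
  proof (rule tannery_sequence)
    define D where "D = K * B * 2 powr \<bar>\<beta>\<bar>"
    have D0: "D \<ge> 0" using K(1) B0 by (simp add: D_def)
    have bound: "\<bar>h i m\<bar> \<le> D * real (Suc i) powr \<alpha> * real (Suc m) powr (\<beta> - \<alpha>)" for i m
    proof (cases "2 * i < m")
      case True
      have "\<bar>b (m - i)\<bar> \<le> B * real (Suc (m - i)) powr \<beta>" by (rule b)
      also have "\<dots> = B * ((real (Suc (m - i)) / real (Suc m)) powr \<beta> * real (Suc m) powr \<beta>)"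
        by (simp add: powr_divide)
      also have "\<dots> \<le> B * (2 powr \<bar>\<beta>\<bar> * real (Suc m) powr \<beta>)"
        using True B0 by (intro mult_left_mono mult_right_mono powr_le_two_powr_abs)
          (auto simp: field_simps of_nat_diff)
      finally have "\<bar>a i\<bar> * \<bar>b (m - i)\<bar> \<le> K * real (Suc i) powr \<alpha> * (B * (2 powr \<bar>\<beta>\<bar> * real (Suc m) powr \<beta>))"
        using aK[of i] K(1) by (intro mult_mono) auto
      then have "\<bar>h i m\<bar> \<le> K * real (Suc i) powr \<alpha> * (B * (2 powr \<bar>\<beta>\<bar> * real (Suc m) powr \<beta>)) / real (Suc m) powr \<alpha>"
        using True by (simp add: h_def abs_mult divide_right_mono)
      also have "\<dots> = D * real (Suc i) powr \<alpha> * real (Suc m) powr (\<beta> - \<alpha>)"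
        by (simp add: D_def powr_diff)
      finally show ?thesis .
    next
      case False
      then show ?thesis using D0 by (simp add: h_def)
    qed
    fix i
    have "(\<lambda>m. real (Suc m) powr (\<beta> - \<alpha>)) \<longlonglongrightarrow> 0"
      using \<beta> by (intro LIMSEQ_Suc tendsto_neg_powr filterlim_real_sequentially) auto
    from tendsto_mult_right_zero[OF this]
    have "(\<lambda>m. D * real (Suc i) powr \<alpha> * real (Suc m) powr (\<beta> - \<alpha>)) \<longlonglongrightarrow> 0" .
    then show "(\<lambda>m. h i m) \<longlonglongrightarrow> 0"
      by (rule Lim_null_comparison[rotated]) (use bound in \<open>simp only: real_norm_def eventually_sequentially; blast\<close>)
    fix m
    show "\<bar>h i m\<bar> \<le> D * real (Suc i) powr \<beta>"
    proof (cases "2 * i < m")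
      case True
      \<comment> \<open>The exponent is negative and \<open>i\<close> is below \<open>m\<close>, so
        trading \<open>m\<close> for \<open>i\<close> leaves a majorant of order i^\<beta>, which is
        summable and free of \<open>m\<close>.\<close>
      have "real (Suc m) powr (\<beta> - \<alpha>) \<le> real (Suc i) powr (\<beta> - \<alpha>)"
        using True \<beta> by (intro powr_mono2') auto
      with bound[of i m] have "\<bar>h i m\<bar> \<le> D * real (Suc i) powr \<alpha> * real (Suc i) powr (\<beta> - \<alpha>)"
        using D0 by (meson mult_left_mono mult_nonneg_nonneg order_trans powr_ge_zero)
      also have "\<dots> = D * real (Suc i) powr \<beta>" by (simp add: powr_diff)
      finally show ?thesis .
    next
      case False
      then show ?thesis using D0 by (simp add: h_def)
    qed
    show "summable (\<lambda>i. D * real (Suc i) powr \<beta>)"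
      using summable_Suc_powr[OF \<beta>(1)] by (rule summable_mult)
  qed
  ultimately have "(\<lambda>m. (\<Sum>j. g j m) + (\<Sum>i. h i m)) \<longlonglongrightarrow> (\<Sum>j. b j * A) + (\<Sum>i. 0)"
    by (rule tendsto_add)
  moreover have "summable b"
    by (rule summable_comparison_test'[OF sb, of 0]) (use b in simp)
  ultimately show ?thesis
    unfolding eq by (simp add: suminf_mult mult.commute[of _ A])
qed

text \<open>Rescaling the variable moves the point \<open>x\<close> to 1; for
  \<open>x\<^sub>c\<close> the exponential growth disappears and pure power laws remain.\<close>

definition scaled_coeff :: "real \<Rightarrow> real fps \<Rightarrow> nat \<Rightarrow> real" where
  "scaled_coeff x f m = fps_nth f m * x ^ m"

lemma scaled_coeff_mult:
  "scaled_coeff x (f * g) m = (\<Sum>i\<le>m. scaled_coeff x f i * scaled_coeff x g (m - i))"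
  unfolding scaled_coeff_def fps_mult_nth sum_distrib_right atLeast0AtMost
  by (intro sum.cong) (auto simp flip: power_add)

text \<open>One factor \<open>g\<close> is multiplied on at a time. Each convolution keeps the
  exponent \<alpha> and multiplies the constant by the sum of \<open>g\<close>, so the bound on
  \<open>g\<close> itself carries the induction.\<close>

lemma scaled_coeff_mult_power_limit:
  assumes "\<beta> < -1" "\<beta> < \<alpha>"
    and "(\<lambda>m. scaled_coeff x f m / real (Suc m) powr \<alpha>) \<longlonglongrightarrow> A"
    and "\<And>m. \<bar>scaled_coeff x g m\<bar> \<le> B * real (Suc m) powr \<beta>"
  shows "(\<lambda>m. scaled_coeff x (f * g ^ r) m / real (Suc m) powr \<alpha>)
           \<longlonglongrightarrow> A * (\<Sum>m. scaled_coeff x g m) ^ r"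
proof (induction r)
  case 0
  then show ?case using assms(3) by simp
next
  case (Suc r)
  have "scaled_coeff x (f * g ^ Suc r) m
      = (\<Sum>i\<le>m. scaled_coeff x (f * g ^ r) i * scaled_coeff x g (m - i))" for m
    unfolding scaled_coeff_mult[symmetric] by (simp add: mult_ac)
  with convolution_limit[OF assms(1,2) Suc assms(4)] show ?case
    by (simp only: power_Suc2 mult.assoc)
qed

text \<open>Abel's limit theorem in the absolutely convergent case: the Weierstrass test on
  \<open>{0..x}\<close> makes the sum continuous up to the endpoint.\<close>

lemma eval_fps_at_left_limit:
  fixes f :: "real fps"
  assumes x: "x > 0" and s: "summable (\<lambda>m. \<bar>scaled_coeff x f m\<bar>)"
  shows "(eval_fps f \<longlongrightarrow> (\<Sum>m. scaled_coeff x f m)) (at_left x)"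
proof -
  have "uniform_limit {0..x} (\<lambda>n z. \<Sum>m<n. fps_nth f m * z ^ m) (\<lambda>z. \<Sum>m. fps_nth f m * z ^ m) sequentially"
  proof (rule Weierstrass_m_test[OF _ s])
    fix n z assume "z \<in> {0..x}"
    then show "norm (fps_nth f n * z ^ n) \<le> \<bar>scaled_coeff x f n\<bar>"
      by (auto simp: scaled_coeff_def abs_mult intro!: mult_left_mono power_mono)
  qed
  then have "continuous_on {0..x} (\<lambda>z. \<Sum>m. fps_nth f m * z ^ m)"
    by (rule uniform_limit_theorem[rotated])
       (auto intro!: always_eventually continuous_intros)
  then have "((\<lambda>z. \<Sum>m. fps_nth f m * z ^ m) \<longlongrightarrow> (\<Sum>m. fps_nth f m * x ^ m)) (at x within {0..x})"
    using x by (auto simp: continuous_on)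
  moreover have "at x within {0..x} = at_left x"
    using x by (simp add: at_within_Icc_at_left)
  ultimately show ?thesis
    by (simp add: eval_fps_def[abs_def] scaled_coeff_def[abs_def])
qed

section \<open>Weighted generating functions\<close>

text \<open>A size shared by infinitely many elements would give the default value 0 of an infinite
  sum; the finiteness assumptions of the product rules exclude this.\<close>

definition weight_gf :: "'a set \<Rightarrow> ('a \<Rightarrow> nat) \<Rightarrow> ('a \<Rightarrow> real) \<Rightarrow> real fps" where
  "weight_gf A w f = Abs_fps (\<lambda>m. \<Sum>a | a \<in> A \<and> w a = m. f a)"

lemma weight_gf_reindex:
  assumes "bij_betw h A B" "\<And>a. a \<in> A \<Longrightarrow> u (h a) = w a" "\<And>a. a \<in> A \<Longrightarrow> g (h a) = f a"
  shows "weight_gf B u g = weight_gf A w f"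
proof -
  have "(\<Sum>b | b \<in> B \<and> u b = m. g b) = (\<Sum>a | a \<in> A \<and> w a = m. f a)" for m
  proof (rule sum.reindex_bij_betw[symmetric, THEN trans])
    show "bij_betw h {a \<in> A. w a = m} {b \<in> B. u b = m}"
      using assms(1,2) by (auto simp: bij_betw_def inj_on_def)
    show "(\<Sum>a | a \<in> A \<and> w a = m. g (h a)) = (\<Sum>a | a \<in> A \<and> w a = m. f a)"
      using assms(3) by (intro sum.cong) auto
  qed
  then show ?thesis by (simp add: weight_gf_def)
qed

lemma weight_gf_mult:
  assumes A: "\<And>m. finite {a \<in> A. w a \<le> m}" and B: "\<And>m. finite {b \<in> B. u b \<le> m}"
  shows "weight_gf A w f * weight_gf B u g
    = weight_gf (A \<times> B) (\<lambda>(a, b). w a + u b) (\<lambda>(a, b). f a * g b)"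
proof (rule fps_ext)
  fix m
  have fin: "finite {a \<in> A. w a = i}" "finite {b \<in> B. u b = i}" for i
    using A[of i] B[of i] by (auto elim: rev_finite_subset)
  have "fps_nth (weight_gf A w f * weight_gf B u g) m
      = (\<Sum>i=0..m. \<Sum>x\<in>{a \<in> A. w a = i} \<times> {b \<in> B. u b = m - i}. f (fst x) * g (snd x))"
    by (simp add: weight_gf_def fps_mult_nth sum_product sum.cartesian_product case_prod_beta)
  also have "\<dots> = (\<Sum>x\<in>(\<Union>i\<in>{0..m}. {a \<in> A. w a = i} \<times> {b \<in> B. u b = m - i}). f (fst x) * g (snd x))"
    using fin by (intro sum.UNION_disjoint[symmetric]) auto
  also have "(\<Union>i\<in>{0..m}. {a \<in> A. w a = i} \<times> {b \<in> B. u b = m - i})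
      = {x \<in> A \<times> B. w (fst x) + u (snd x) = m}"
    by auto
  finally show "fps_nth (weight_gf A w f * weight_gf B u g) m
      = fps_nth (weight_gf (A \<times> B) (\<lambda>(a, b). w a + u b) (\<lambda>(a, b). f a * g b)) m"
    by (simp add: weight_gf_def case_prod_beta)
qed

definition words :: "'a set \<Rightarrow> nat \<Rightarrow> 'a list set" where
  "words A r = {xs. set xs \<subseteq> A \<and> length xs = r}"

text \<open>No letter weighs more than the whole word, so all letters come from a finite
  set.\<close>

lemma finite_words_weight:
  assumes "\<And>m. finite {a \<in> A. w a \<le> (m::nat)}"
  shows "finite {xs \<in> words A r. sum_list (map w xs) \<le> m}"
proof (rule finite_subset)
  show "{xs \<in> words A r. sum_list (map w xs) \<le> m} \<subseteq> {xs. set xs \<subseteq> {a \<in> A. w a \<le> m} \<and> length xs = r}"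
    using member_le_sum_list[of _ "map w _"] by (fastforce simp: words_def)
  show "finite \<dots>" using assms by (intro finite_lists_length_eq)
qed

lemma weight_gf_power:
  assumes "\<And>m. finite {a \<in> A. w a \<le> m}"
  shows "weight_gf A w (\<lambda>_. 1) ^ r = weight_gf (words A r) (\<lambda>xs. sum_list (map w xs)) (\<lambda>_. 1)"
proof (induction r)
  case 0
  have "{xs \<in> words A 0. sum_list (map w xs) = m} = (if m = 0 then {[]} else {})" for m
    by (auto simp: words_def)
  then show ?case by (auto simp: weight_gf_def fps_eq_iff)
next
  case (Suc r)
  have "weight_gf A w (\<lambda>_. 1) ^ Suc r
      = weight_gf (A \<times> words A r) (\<lambda>(a, xs). w a + sum_list (map w xs)) (\<lambda>(a, xs). 1 * 1)"
    unfolding power_Suc Suc by (rule weight_gf_mult[OF assms finite_words_weight[OF assms]])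
  also have "\<dots> = weight_gf (words A (Suc r)) (\<lambda>xs. sum_list (map w xs)) (\<lambda>_. 1)"
  proof (rule weight_gf_reindex[symmetric])
    show "bij_betw (\<lambda>(a, xs). a # xs) (A \<times> words A r) (words A (Suc r))"
      by (rule bij_betwI[where g = "\<lambda>xs. (hd xs, tl xs)"]) (auto simp: words_def length_Suc_conv)
  qed auto
  finally show ?case .
qed

lemma weight_gf_mult_power:
  assumes "\<And>m. finite {a \<in> A. w a \<le> m}" "\<And>m. finite {b \<in> B. u b \<le> m}"
  shows "fps_nth (weight_gf A w f * weight_gf B u (\<lambda>_. 1) ^ r) m
    = (\<Sum>(a, xs) | a \<in> A \<and> xs \<in> words B r \<and> w a + sum_list (map u xs) = m. f a)"
  unfolding weight_gf_power[OF assms(2)] weight_gf_mult[OF assms(1) finite_words_weight[OF assms(2)]]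
  by (auto simp: weight_gf_def case_prod_beta intro!: sum.cong)

section \<open>Moments as sums over representatives\<close>

definition representatives :: "polygon set \<Rightarrow> polygon set" where
  "representatives C = {P \<in> C. anchor P = 0}"

lemma polygon_classD:
  assumes "polygon_class C" "P \<in> C"
  shows "self_avoiding_polygon P" "translate v P \<in> C"
  using assms unfolding polygon_class_def by blast+

lemma representatives_vertices:
  assumes "polygon_class C" "P \<in> representatives C"
  shows "self_avoiding_polygon P" "0 \<in> \<Union>P" "\<Union>P \<subseteq> lattice_square 0 (8 * int (half_perimeter P) + 4)"
proof -
  show P: "self_avoiding_polygon P" using assms polygon_classD(1) by (auto simp: representatives_def)
  show 0: "0 \<in> \<Union>P" using sap_anchor_mem[OF P] assms(2) by (simp add: representatives_def)
  show "\<Union>P \<subseteq> lattice_square 0 (8 * int (half_perimeter P) + 4)" by (rule sap_vertices_bound[OF P 0])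
qed

lemma finite_representatives:
  assumes "polygon_class C"
  shows "finite {P \<in> representatives C. half_perimeter P \<le> m}"
proof (rule finite_subset)
  show "{P \<in> representatives C. half_perimeter P \<le> m} \<subseteq> Pow (Pow (lattice_square 0 (8 * int m + 4)))"
  proof (intro subsetI PowI)
    fix P e u assume P: "P \<in> {P \<in> representatives C. half_perimeter P \<le> m}" and "e \<in> P" "u \<in> e"
    then have "u \<in> lattice_square 0 (8 * int (half_perimeter P) + 4)"
      using representatives_vertices(3)[OF assms, of P] by blast
    with P show "u \<in> lattice_square 0 (8 * int m + 4)" by (auto simp: mem_lattice_square)
  qed
qed simp

text \<open>Double counting by the value of \<open>g\<close>; outside the finite image the fibres
  are empty. It links moments, which are defined through counts per area, with finite sums over
  polygons.\<close>

lemma suminf_card_fibres: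
  fixes g :: "'a \<Rightarrow> nat" and h :: "nat \<Rightarrow> real"
  assumes "finite A"
  shows "(\<Sum>n. h n * real (card {a \<in> A. g a = n})) = (\<Sum>a\<in>A. h (g a))"
proof -
  have "(\<Sum>n. h n * real (card {a \<in> A. g a = n})) = (\<Sum>n\<in>g ` A. h n * real (card {a \<in> A. g a = n}))"
  proof (rule suminf_finite)
    fix n assume "n \<notin> g ` A"
    then have "{a \<in> A. g a = n} = {}" by auto
    then show "h n * real (card {a \<in> A. g a = n}) = 0" by (simp only: card.empty of_nat_0 mult_zero_right)
  qed (use assms in simp)
  also have "\<dots> = (\<Sum>n\<in>g ` A. \<Sum>a | a \<in> A \<and> g a = n. h (g a))"
    by (intro sum.cong) auto
  also have "\<dots> = (\<Sum>a\<in>A. h (g a))"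
    using assms by (rule sum.image_gen[symmetric])
  finally show ?thesis .
qed

lemma num_polygons_eq:
  assumes "polygon_class C"
  shows "num_polygons C m n = card {P \<in> {P \<in> representatives C. half_perimeter P = m}. area P = n}"
proof -
  have "num_polygons C m n = card {P \<in> {P \<in> C. half_perimeter P = m \<and> area P = n}. anchor P = 0}"
    unfolding num_polygons_def translation_rel_def
    by (rule card_quotient_by_action)
      (simp_all add: polygon_classD[OF assms] translate_add sap_anchor_translate)
  then show ?thesis by (simp add: representatives_def conj_ac cong: conj_cong)
qed

lemma area_moment_eq:
  assumes "polygon_class C"
  shows "area_moment C k m = (\<Sum>P | P \<in> representatives C \<and> half_perimeter P = m. real (area P) ^ k)"
  unfolding area_moment_def num_polygons_eq[OF assms]
  using finite_representatives[OF assms, of m] by (intro suminf_card_fibres) (auto elim: rev_finite_subset)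

lemma moment_gf_eq:
  assumes "polygon_class C"
  shows "moment_gf C k = weight_gf (representatives C) half_perimeter (\<lambda>P. real (area P) ^ k)"
  by (simp add: moment_gf_def weight_gf_def area_moment_eq[OF assms])

section \<open>Punctured polygons modulo translation\<close>

definition punctured_translate :: "vertex \<Rightarrow> punctured_polygon \<Rightarrow> punctured_polygon" where
  "punctured_translate v X = (translate v (fst X), translate v ` snd X)"

lemma punctured_translate_0: "punctured_translate 0 X = X"
  by (simp add: punctured_translate_def)

lemma punctured_translate_add:
  "punctured_translate (u + v) X = punctured_translate u (punctured_translate v X)"
  by (simp add: punctured_translate_def image_image translate_add[abs_def])

lemma punctured_translate_mem:
  assumes C: "polygon_class C" and X: "X \<in> punctured_polygons C r"
  shows "punctured_translate v X \<in> punctured_polygons C r"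
proof -
  obtain P H where PH: "X = (P, H)" "P \<in> C" "H \<subseteq> C" "finite H" "card H = r"
      "\<And>Q. Q \<in> H \<Longrightarrow> curve Q \<subseteq> inside (curve P)" "disjoint_family_on curve (insert P H)"
    using X by (auto simp: punctured_polygons_def)
  have "disjoint_family_on curve (translate v ` insert P H)"
    unfolding disjoint_family_on_def
  proof (intro ballI impI)
    fix Q Q' assume "Q \<in> translate v ` insert P H" "Q' \<in> translate v ` insert P H" "Q \<noteq> Q'"
    then obtain S S' where S: "Q = translate v S" "Q' = translate v S'" "S \<in> insert P H" "S' \<in> insert P H" "S \<noteq> S'"
      by blast
    then have "curve S \<inter> curve S' = {}" using PH(7) by (meson disjoint_family_onD)
    then show "curve Q \<inter> curve Q' = {}"
      unfolding S curve_translate by auto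
  qed
  moreover have "curve (translate v Q) \<subseteq> inside (curve (translate v P))" if "Q \<in> H" for Q
    unfolding curve_translate inside_translation using PH(6)[OF that] by (rule image_mono)
  moreover have "card (translate v ` H) = r"
    using PH(5) by (simp add: card_image[OF inj_on_subset[OF inj_translate subset_UNIV]])
  moreover have "translate v P \<in> C" "translate v ` H \<subseteq> C"
    using PH(2,3) polygon_classD(2)[OF C] by blast+
  ultimately show ?thesis
    using PH(1,4) unfolding punctured_translate_def punctured_polygons_def by simp
qed

lemma punctured_half_perimeter_translate:
  "punctured_half_perimeter (punctured_translate v X) = punctured_half_perimeter X"
  by (simp add: punctured_half_perimeter_def punctured_translate_def
      sum.reindex[OF inj_on_subset[OF inj_translate subset_UNIV]])

lemma punctured_area_translate: "punctured_area (punctured_translate v X) = punctured_area X"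
  by (simp add: punctured_area_def punctured_translate_def
      sum.reindex[OF inj_on_subset[OF inj_translate subset_UNIV]])

text \<open>Outer polygon and holes move jointly, so anchoring the outer polygon fixes the whole
  figure.\<close>

definition anchored_punctured :: "polygon set \<Rightarrow> nat \<Rightarrow> nat \<Rightarrow> punctured_polygon set" where
  "anchored_punctured C r m =
     {X \<in> punctured_polygons C r. anchor (fst X) = 0 \<and> punctured_half_perimeter X = m}"

lemma num_punctured_eq:
  assumes "polygon_class C"
  shows "num_punctured C r m n = card {X \<in> anchored_punctured C r m. punctured_area X = int n}"
proof -
  let ?X = "{X \<in> punctured_polygons C r. punctured_half_perimeter X = m \<and> punctured_area X = int n}"
  have "card (?X // {(x, y). \<exists>v. y = punctured_translate v x}) = card {X \<in> ?X. anchor (fst X) = 0}"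
  proof (rule card_quotient_by_action)
    fix v X assume "X \<in> ?X"
    then have "fst X \<in> C" by (auto simp: punctured_polygons_def)
    then show "anchor (fst (punctured_translate v X)) = v + anchor (fst X)"
      using polygon_classD(1)[OF assms] by (simp add: punctured_translate_def sap_anchor_translate)
  qed (simp_all add: punctured_translate_mem[OF assms] punctured_translate_0 punctured_translate_add
      punctured_half_perimeter_translate punctured_area_translate)
  then show ?thesis
    unfolding num_punctured_def punctured_translation_rel_def punctured_translate_def anchored_punctured_def
    by (simp add: conj_ac cong: conj_cong)
qed

text \<open>Negative areas, which occur for nested holes, are not counted by the moments.\<close>

definition nonneg_power :: "nat \<Rightarrow> int \<Rightarrow> real" where
  "nonneg_power k z = (if z \<ge> 0 then real_of_int z ^ k else 0)"

lemma punctured_moment_eq: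
  assumes C: "polygon_class C" and fin: "finite (anchored_punctured C r m)"
  shows "punctured_moment C r k m = (\<Sum>X\<in>anchored_punctured C r m. nonneg_power k (punctured_area X))"
proof -
  let ?A = "{X \<in> anchored_punctured C r m. punctured_area X \<ge> 0}"
  have "punctured_area X = int n \<longleftrightarrow> punctured_area X \<ge> 0 \<and> nat (punctured_area X) = n" for X n
    by auto
  then have "punctured_moment C r k m
      = (\<Sum>n. real n ^ k * real (card {X \<in> ?A. nat (punctured_area X) = n}))"
    unfolding punctured_moment_def num_punctured_eq[OF C] by (simp add: conj_assoc)
  also have "\<dots> = (\<Sum>X\<in>?A. real (nat (punctured_area X)) ^ k)"
    using fin by (intro suminf_card_fibres) simp
  also have "\<dots> = (\<Sum>X\<in>?A. nonneg_power k (punctured_area X))"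
    by (intro sum.cong) (auto simp: nonneg_power_def)
  also have "\<dots> = (\<Sum>X\<in>anchored_punctured C r m. nonneg_power k (punctured_area X))"
    using fin by (intro sum.mono_neutral_left) (auto simp: nonneg_power_def)
  finally show ?thesis .
qed

section \<open>Placing holes\<close>

definition place :: "vertex list \<Rightarrow> polygon list \<Rightarrow> polygon list" where
  "place vs Qs = map2 translate vs Qs"

text \<open>When the entries of \<open>Qs\<close> are representatives, \<open>vs ! i\<close> is the
  anchor of the hole placed in position \<open>i\<close>.\<close>

definition placements :: "polygon set \<Rightarrow> polygon \<Rightarrow> polygon list \<Rightarrow> vertex list set" where
  "placements C P Qs = {vs. length vs = length Qs \<and> distinct (place vs Qs) \<and>
     (P, set (place vs Qs)) \<in> punctured_polygons C (length Qs)}"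

text \<open>The index set of the coefficient of x^m in the product of one outer series and
  \<open>r\<close> hole series; the positions of the holes are left open.\<close>

definition configurations :: "polygon set \<Rightarrow> nat \<Rightarrow> nat \<Rightarrow> (polygon \<times> polygon list) set" where
  "configurations C r m = {(P, Qs). P \<in> representatives C \<and> Qs \<in> words (representatives C) r \<and>
     half_perimeter P + sum_list (map half_perimeter Qs) = m}"

definition net_area :: "polygon \<Rightarrow> polygon list \<Rightarrow> int" where
  "net_area P Qs = int (area P) - (\<Sum>Q\<leftarrow>Qs. int (area Q))"

lemma length_place: "length vs = length Qs \<Longrightarrow> length (place vs Qs) = length Qs"
  by (simp add: place_def)

lemma nth_place:
  "i < length Qs \<Longrightarrow> length vs = length Qs \<Longrightarrow> place vs Qs ! i = translate (vs ! i) (Qs ! i)"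
  by (simp add: place_def)

lemma map_place:
  assumes "length vs = length Qs" "\<And>v Q. f (translate v Q) = f Q"
  shows "map f (place vs Qs) = map f Qs"
  by (rule nth_equalityI) (use assms in \<open>auto simp: length_place nth_place\<close>)

text \<open>The origin is a vertex of each representative, so \<open>vs ! i\<close> is a vertex of
  the placed hole and lies inside \<open>P\<close>.\<close>

lemma placements_subset:
  assumes C: "polygon_class C" and Qs: "Qs \<in> words (representatives C) r"
  shows "placements C P Qs \<subseteq> {vs. set vs \<subseteq> interior_cells P \<and> length vs = r}"
proof
  fix vs assume vs: "vs \<in> placements C P Qs"
  have len: "length vs = r" "length Qs = r" using vs Qs by (auto simp: placements_def words_def)
  have punct: "(P, set (place vs Qs)) \<in> punctured_polygons C r"
    using vs len by (simp add: placements_def)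
  then have P: "self_avoiding_polygon P" using polygon_classD(1)[OF C] by (auto simp: punctured_polygons_def)
  have "vs ! i \<in> interior_cells P" if i: "i < r" for i
  proof (rule interior_cell_of_inside_point[OF P])
    have "translate (vs ! i) (Qs ! i) \<in> set (place vs Qs)"
      using i len by (metis length_place nth_mem nth_place)
    then have "curve (translate (vs ! i) (Qs ! i)) \<subseteq> inside (curve P)"
      using punct by (auto simp: punctured_polygons_def)
    moreover have "Qs ! i \<in> representatives C" using Qs i by (auto simp: words_def)
    then have "vs ! i + 0 \<in> \<Union>(translate (vs ! i) (Qs ! i))"
      unfolding Union_translate using representatives_vertices(2)[OF C] by (intro imageI)
    then have "point (vs ! i) \<in> curve (translate (vs ! i) (Qs ! i))"
      by (intro point_mem_curve) simp
    ultimately show "point (vs ! i) \<in> inside (curve P)" by blast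
  qed
  then have "set vs \<subseteq> interior_cells P"
    using len(1) by (metis in_set_conv_nth subsetI)
  then show "vs \<in> {vs. set vs \<subseteq> interior_cells P \<and> length vs = r}"
    using len by simp
qed

text \<open>Forgetting the disjointness of the holes leaves all lists of length \<open>r\<close>
  over the interior cells.\<close>

lemma card_placements_upper:
  assumes C: "polygon_class C" and P: "P \<in> representatives C" and Qs: "Qs \<in> words (representatives C) r"
  shows "card (placements C P Qs) \<le> area P ^ r" "finite (placements C P Qs)"
proof -
  have fin: "finite (interior_cells P)"
    using finite_interior_cells representatives_vertices(1)[OF C P] by blast
  show "finite (placements C P Qs)"
    using placements_subset[OF C Qs] finite_lists_length_eq[OF fin] by (rule finite_subset)
  show "card (placements C P Qs) \<le> area P ^ r"
    using card_mono[OF finite_lists_length_eq[OF fin] placements_subset[OF C Qs]]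
    by (simp add: area_eq card_lists_length_eq[OF fin])
qed

lemma finite_configurations:
  assumes "polygon_class C"
  shows "finite (configurations C r m)"
proof (rule finite_subset)
  show "configurations C r m \<subseteq> {P \<in> representatives C. half_perimeter P \<le> m} \<times>
      {Qs \<in> words (representatives C) r. sum_list (map half_perimeter Qs) \<le> m}"
    by (auto simp: configurations_def)
  show "finite \<dots>"
    using finite_representatives[OF assms] finite_words_weight[OF finite_representatives[OF assms]] by blast
qed

text \<open>Listing the holes of a punctured polygon in all possible orders and recording for each hole its
  anchor and its representative counts every punctured polygon exactly \<open>r!\<close> times.\<close>

lemma ordered_holes_bij:
  assumes C: "polygon_class C"
  shows "bij_betw (\<lambda>((P, Qs), vs). ((P, set (place vs Qs)), place vs Qs))
     (SIGMA (P, Qs):configurations C r m. placements C P Qs)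
     (SIGMA X:anchored_punctured C r m. permutations_of_set (snd X))" (is "bij_betw ?f ?S ?T")
proof (rule bij_betwI[where g = "\<lambda>((P, H), l). ((P, map (\<lambda>Q. translate (- anchor Q) Q) l), map anchor l)"])
  \<comment> \<open>Translating by the negative anchor produces the representative, and the anchor
    remembers the translation that undoes this.\<close>
  let ?n = "\<lambda>Q. translate (- anchor Q) Q"
  have place_inv: "place (map anchor l) (map ?n l) = l" for l
    by (rule nth_equalityI) (auto simp: place_def simp flip: translate_add)
  show "?f \<in> ?S \<rightarrow> ?T"
  proof
    fix x assume "x \<in> ?S"
    then obtain P Qs vs where x: "x = ((P, Qs), vs)" and conf: "(P, Qs) \<in> configurations C r m"
      and vs: "vs \<in> placements C P Qs" by auto
    have len: "length vs = length Qs" "length Qs = r"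
      using conf vs by (auto simp: configurations_def placements_def words_def)
    have "(\<Sum>Q\<in>set (place vs Qs). half_perimeter Q) = sum_list (map half_perimeter (place vs Qs))"
      using vs by (intro sum.distinct_set_conv_list) (simp add: placements_def)
    also have "\<dots> = sum_list (map half_perimeter Qs)"
      using len by (simp add: map_place)
    finally have "punctured_half_perimeter (P, set (place vs Qs)) = m"
      using conf by (simp add: punctured_half_perimeter_def configurations_def)
    then show "?f x \<in> ?T"
      using x conf vs len by (auto simp: anchored_punctured_def placements_def configurations_def
          representatives_def permutations_of_set_def)
  qed
  show "(\<lambda>((P, H), l). ((P, map ?n l), map anchor l)) \<in> ?T \<rightarrow> ?S"
  proof
    fix y assume "y \<in> ?T"
    then obtain P H l where y: "y = ((P, H), l)" and PH: "(P, H) \<in> anchored_punctured C r m"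
      and l: "set l = H" "distinct l" by (auto simp: permutations_of_set_def)
    have H: "P \<in> C" "H \<subseteq> C" "card H = r" "(P, H) \<in> punctured_polygons C r" "anchor P = 0"
        "punctured_half_perimeter (P, H) = m"
      using PH by (auto simp: anchored_punctured_def punctured_polygons_def)
    have "?n Q \<in> representatives C" if "Q \<in> H" for Q
    proof -
      have "Q \<in> C" using that H(2) by blast
      then show ?thesis
        using polygon_classD[OF C] by (simp add: representatives_def sap_anchor_translate)
    qed
    then have words: "map ?n l \<in> words (representatives C) r"
      using l H(3) distinct_card[OF l(2)] by (auto simp: words_def)
    have "(\<Sum>Q\<in>H. half_perimeter Q) = sum_list (map half_perimeter l)"
      using l by (metis sum.distinct_set_conv_list)
    then have "half_perimeter P + sum_list (map half_perimeter (map ?n l)) = m"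
      using H(6) by (simp add: punctured_half_perimeter_def o_def)
    then have "(P, map ?n l) \<in> configurations C r m"
      using words H by (simp add: configurations_def representatives_def)
    moreover have "map anchor l \<in> placements C P (map ?n l)"
      using l H distinct_card[OF l(2)] by (simp add: placements_def place_inv)
    ultimately show "(\<lambda>((P, H), l). ((P, map ?n l), map anchor l)) y \<in> ?S"
      by (simp add: y)
  qed
  show "(\<lambda>((P, H), l). ((P, map ?n l), map anchor l)) (?f x) = x" if x_mem: "x \<in> ?S" for x
  proof -
    obtain P Qs vs where x: "x = ((P, Qs), vs)" and conf: "(P, Qs) \<in> configurations C r m"
      and vs: "vs \<in> placements C P Qs" using x_mem by auto
    have len: "length vs = length Qs" using vs by (simp add: placements_def)
    \<comment> \<open>Representatives have anchor 0, so the anchor of a placed hole returns its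
      translation vector.\<close>
    have anc: "anchor (place vs Qs ! i) = vs ! i" if "i < length Qs" for i
    proof -
      have "Qs ! i \<in> representatives C" using conf that by (auto simp: configurations_def words_def)
      then have "self_avoiding_polygon (Qs ! i)" "anchor (Qs ! i) = 0"
        using representatives_vertices(1)[OF C] by (auto simp: representatives_def)
      then show ?thesis using that len by (simp add: nth_place sap_anchor_translate)
    qed
    have "map anchor (place vs Qs) = vs"
      by (rule nth_equalityI) (use anc len in \<open>auto simp: length_place\<close>)
    moreover have "map ?n (place vs Qs) = Qs"
      by (rule nth_equalityI) (use anc len in \<open>auto simp: length_place nth_place simp flip: translate_add\<close>)
    ultimately show ?thesis by (simp add: x)
  qed
  show "?f ((\<lambda>((P, H), l). ((P, map ?n l), map anchor l)) y) = y" if "y \<in> ?T" for y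
    using that by (auto simp: place_inv permutations_of_set_def)
qed

text \<open>Every hole set has at least one ordering, so these figures are the first components of a
  set that \<open>ordered_holes_bij\<close> matches with a finite one.\<close>

lemma finite_anchored_punctured:
  assumes C: "polygon_class C"
  shows "finite (anchored_punctured C r m)"
proof -
  let ?T = "SIGMA X:anchored_punctured C r m. permutations_of_set (snd X)"
  have "finite (SIGMA (P, Qs):configurations C r m. placements C P Qs)"
    using finite_configurations[OF C] card_placements_upper(2)[OF C]
    by (intro finite_SigmaI) (auto simp: configurations_def)
  then have "finite ?T"
    using bij_betw_finite[OF ordered_holes_bij[OF C]] by blast
  moreover have "X \<in> fst ` ?T" if X: "X \<in> anchored_punctured C r m" for X
  proof -
    have "finite (snd X)" using X by (auto simp: anchored_punctured_def punctured_polygons_def)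
    then obtain l where "l \<in> permutations_of_set (snd X)" by (metis permutations_of_setI finite_distinct_list)
    with X show ?thesis by force
  qed
  ultimately show ?thesis by (meson finite_imageI finite_subset subsetI)
qed

section \<open>Moment identity and upper bound\<close>

lemma punctured_area_place:
  assumes "vs \<in> placements C P Qs"
  shows "punctured_area (P, set (place vs Qs)) = net_area P Qs"
proof -
  have "(\<Sum>Q\<in>set (place vs Qs). int (area Q)) = sum_list (map (\<lambda>Q. int (area Q)) (place vs Qs))"
    using assms by (intro sum.distinct_set_conv_list) (simp add: placements_def)
  also have "\<dots> = (\<Sum>Q\<leftarrow>Qs. int (area Q))"
    using assms by (subst map_place) (auto simp: placements_def)
  finally show ?thesis by (simp add: punctured_area_def net_area_def)
qed

text \<open>Both sides sum the same weight over punctured polygons with ordered holes: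
  \<open>fact r\<close> counts the orderings, \<open>placements\<close> the positions, and the area
  depends only on the shapes.\<close>

lemma punctured_moment_configurations:
  assumes C: "polygon_class C"
  shows "fact r * punctured_moment C r k m
    = (\<Sum>(P, Qs)\<in>configurations C r m. real (card (placements C P Qs)) * nonneg_power k (net_area P Qs))"
proof -
  let ?S = "SIGMA (P, Qs):configurations C r m. placements C P Qs"
  let ?T = "SIGMA X:anchored_punctured C r m. permutations_of_set (snd X)"
  have perm: "finite (permutations_of_set (snd X)) \<and> card (permutations_of_set (snd X)) = fact r"
    if "X \<in> anchored_punctured C r m" for X
    using that by (auto simp: anchored_punctured_def punctured_polygons_def)
  have "fact r * punctured_moment C r k m
      = (\<Sum>X\<in>anchored_punctured C r m. \<Sum>l\<in>permutations_of_set (snd X). nonneg_power k (punctured_area X))"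
    unfolding punctured_moment_eq[OF C finite_anchored_punctured[OF C]] sum_distrib_left
    using perm by (intro sum.cong) auto
  also have "\<dots> = (\<Sum>(X, l)\<in>?T. nonneg_power k (punctured_area X))"
    using perm finite_anchored_punctured[OF C] by (intro sum.Sigma) auto
  also have "\<dots> = (\<Sum>((P, Qs), vs)\<in>?S. nonneg_power k (net_area P Qs))"
    unfolding sum.reindex_bij_betw[OF ordered_holes_bij[OF C], symmetric]
    by (intro sum.cong) (auto simp: punctured_area_place)
  also have "\<dots> = (\<Sum>(P, Qs)\<in>configurations C r m. \<Sum>vs\<in>placements C P Qs. nonneg_power k (net_area P Qs))"
    using finite_configurations[OF C] card_placements_upper(2)[OF C]
    by (subst sum.Sigma[symmetric]) (auto simp: configurations_def case_prod_beta)
  finally show ?thesis by simp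
qed

lemma nonneg_power_nonneg: "nonneg_power k z \<ge> 0"
  by (simp add: nonneg_power_def)

text \<open>Bounding the net area by that of the outer polygon gives \<open>k\<close> factors
  \<open>area P\<close>, and counting placements gives \<open>r\<close> more; this is why the moment
  of order \<open>k + r\<close> appears.\<close>

lemma punctured_moment_upper:
  assumes C: "polygon_class C"
  shows "fact r * punctured_moment C r k m \<le> fps_nth (moment_gf C (k + r) * moment_gf C 0 ^ r) m"
proof -
  have "fact r * punctured_moment C r k m
      \<le> (\<Sum>(P, Qs)\<in>configurations C r m. real (area P) ^ (k + r))"
    unfolding punctured_moment_configurations[OF C]
  proof (intro sum_mono, clarify)
    fix P Qs assume PQ: "(P, Qs) \<in> configurations C r m"
    have "(\<Sum>Q\<leftarrow>Qs. int (area Q)) \<ge> 0" by (intro sum_list_nonneg) auto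
    then have "nonneg_power k (net_area P Qs) \<le> real (area P) ^ k"
      by (auto simp: nonneg_power_def net_area_def intro!: power_mono)
    moreover have "real (card (placements C P Qs)) \<le> real (area P) ^ r"
      using card_placements_upper(1)[OF C, of P Qs r] PQ
      by (auto simp: configurations_def simp flip: of_nat_power)
    ultimately have "real (card (placements C P Qs)) * nonneg_power k (net_area P Qs)
        \<le> real (area P) ^ r * real (area P) ^ k"
      by (intro mult_mono nonneg_power_nonneg) auto
    then show "real (card (placements C P Qs)) * nonneg_power k (net_area P Qs) \<le> real (area P) ^ (k + r)"
      by (simp add: power_add mult.commute)
  qed
  also have "\<dots> = fps_nth (moment_gf C (k + r) * moment_gf C 0 ^ r) m"
    unfolding moment_gf_eq[OF C] power_0
      weight_gf_mult_power[OF finite_representatives[OF C] finite_representatives[OF C]]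
    by (simp add: configurations_def case_prod_beta)
  finally show ?thesis .
qed

section \<open>Lower bound for holes of bounded half-perimeter\<close>

lemma sum_list_le_length_mult:
  fixes f :: "'a \<Rightarrow> nat"
  assumes "\<And>x. x \<in> set xs \<Longrightarrow> f x \<le> b"
  shows "sum_list (map f xs) \<le> length xs * b"
  using assms by (induction xs) (auto simp: add_mono)

text \<open>Lists grow at the front, and every entry already present excludes at most
  \<open>K\<close> candidates for the new one. The fixed bound \<open>N\<close> on the length makes
  all factors equal; truncated subtraction covers the case that no candidates are
  guaranteed.\<close>

lemma card_sorted_wrt_lists:
  assumes "finite T" and K: "\<And>v. card {u \<in> T. \<not> R u v} \<le> K" and "n \<le> N"
  shows "(card T - N * K) ^ n \<le> card {vs. length vs = n \<and> set vs \<subseteq> T \<and> sorted_wrt R vs}"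
  using \<open>n \<le> N\<close>
proof (induction n)
  case 0
  have "{vs. length vs = 0 \<and> set vs \<subseteq> T \<and> sorted_wrt R vs} = {[]}" by auto
  then show ?case by simp
next
  case (Suc n)
  define S where "S = {vs. length vs = n \<and> set vs \<subseteq> T \<and> sorted_wrt R vs}"
  have finS: "finite S"
    by (rule finite_subset[OF _ finite_lists_length_eq[OF \<open>finite T\<close>, of n]]) (auto simp: S_def)
  have new: "card T - N * K \<le> card {u \<in> T. \<forall>v\<in>set vs. R u v}" if "vs \<in> S" for vs
  proof -
    have "card (\<Union>v\<in>set vs. {u \<in> T. \<not> R u v}) \<le> (\<Sum>v\<in>set vs. card {u \<in> T. \<not> R u v})"
      by (rule card_UN_le) simp
    also have "\<dots> \<le> card (set vs) * K" using K sum_bounded_above[of "set vs" _ K] by simp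
    also have "\<dots> \<le> N * K"
      using that Suc.prems card_length[of vs] by (intro mult_right_mono) (auto simp: S_def)
    finally have "card T - N * K \<le> card T - card (\<Union>v\<in>set vs. {u \<in> T. \<not> R u v})" by simp
    also have "\<dots> \<le> card (T - (\<Union>v\<in>set vs. {u \<in> T. \<not> R u v}))"
      by (rule diff_card_le_card_Diff) (use \<open>finite T\<close> in auto)
    also have "T - (\<Union>v\<in>set vs. {u \<in> T. \<not> R u v}) = {u \<in> T. \<forall>v\<in>set vs. R u v}" by auto
    finally show ?thesis .
  qed
  have "{vs. length vs = Suc n \<and> set vs \<subseteq> T \<and> sorted_wrt R vs}
      = (\<lambda>(vs, u). u # vs) ` (SIGMA vs:S. {u \<in> T. \<forall>v\<in>set vs. R u v})" (is "?L = _")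
    by (auto simp: S_def length_Suc_conv image_iff)
  moreover have "inj_on (\<lambda>(vs, u). u # vs) X" for X :: "('a list \<times> 'a) set" by (auto simp: inj_on_def)
  ultimately have "card ?L = card (SIGMA vs:S. {u \<in> T. \<forall>v\<in>set vs. R u v})"
    by (simp add: card_image)
  also have "\<dots> = (\<Sum>vs\<in>S. card {u \<in> T. \<forall>v\<in>set vs. R u v})"
    using finS \<open>finite T\<close> by (simp add: card_SigmaI)
  finally have cardL: "card ?L = (\<Sum>vs\<in>S. card {u \<in> T. \<forall>v\<in>set vs. R u v})" .
  have "(card T - N * K) ^ n \<le> card S"
    using Suc by (simp add: S_def)
  then have "(card T - N * K) ^ Suc n \<le> card S * (card T - N * K)"
    unfolding power_Suc2 by (rule mult_right_mono) simp
  also have "\<dots> \<le> card ?L"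
    unfolding cardL using sum_bounded_below[of S "card T - N * K"] new by simp
  finally show ?case .
qed

text \<open>Bernoulli's inequality for (1 - E/N)^p, multiplied by N^p. If \<open>E\<close> exceeds
  \<open>N\<close>, the truncated difference is 0 and the left-hand side is at most 0.\<close>

lemma bernoulli_truncated_diff:
  assumes "p \<ge> 1"
  shows "real N ^ p - real p * real E * real N ^ (p - 1) \<le> real (N - E) ^ p"
proof (cases "E \<le> N")
  case True
  have "real N ^ Suc q - real (Suc q) * real E * real N ^ q \<le> (real N - real E) ^ Suc q" for q
  proof (induction q)
    case (Suc q)
    \<comment> \<open>Multiplying out leaves the left-hand side for the next exponent plus a
      nonnegative square term, which is dropped.\<close>
    have "(real N ^ Suc q - real (Suc q) * real E * real N ^ q) * (real N - real E)
        = real N ^ Suc (Suc q) - real (Suc (Suc q)) * real E * real N ^ Suc q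
          + real (Suc q) * (real E)\<^sup>2 * real N ^ q"
      by (simp add: algebra_simps power2_eq_square)
    moreover have "(real N ^ Suc q - real (Suc q) * real E * real N ^ q) * (real N - real E)
        \<le> (real N - real E) ^ Suc q * (real N - real E)"
      using True by (intro mult_right_mono Suc) auto
    moreover have "real (Suc q) * (real E)\<^sup>2 * real N ^ q \<ge> 0" by simp
    ultimately show ?case by (simp only: power_Suc2)
  qed simp
  from this[of "p - 1"] show ?thesis using True assms by (simp add: of_nat_diff)
next
  case False
  have "real N ^ p = real N * real N ^ (p - 1)" using assms by (simp flip: power_Suc)
  also have "\<dots> \<le> (real p * real E) * real N ^ (p - 1)"
  proof (rule mult_right_mono)
    have "1 * real N \<le> real p * real E" using False assms by (intro mult_mono) auto
    then show "real N \<le> real p * real E" by simp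
  qed simp
  finally show ?thesis using False assms by (simp add: zero_power)
qed

text \<open>Squares replace the holes, so that convexity of the squares settles the inclusion in the outer
  polygon and no connectedness of the holes is needed.\<close>

lemma far_placements_subset:
  assumes C: "polygon_class C" and P: "P \<in> representatives C" and Qs: "Qs \<in> words (representatives C) r"
    and l: "l \<ge> 1" "\<And>Q. Q \<in> set Qs \<Longrightarrow> \<Union>Q \<subseteq> lattice_square 0 l"
  shows "{vs. length vs = r \<and> set vs \<subseteq> {v \<in> interior_cells P. solid_square v l \<inter> curve P = {}} \<and>
      sorted_wrt (\<lambda>u v. u \<notin> lattice_square v (2 * l)) vs} \<subseteq> placements C P Qs"
proof
  fix vs assume "vs \<in> {vs. length vs = r \<and> set vs \<subseteq> {v \<in> interior_cells P. solid_square v l \<inter> curve P = {}} \<and>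
      sorted_wrt (\<lambda>u v. u \<notin> lattice_square v (2 * l)) vs}"
  then have "length vs = r" and sub: "set vs \<subseteq> {v \<in> interior_cells P. solid_square v l \<inter> curve P = {}}"
      and sorted: "sorted_wrt (\<lambda>u v. u \<notin> lattice_square v (2 * l)) vs" by blast+
  have nth: "vs ! i \<in> {v \<in> interior_cells P. solid_square v l \<inter> curve P = {}}" if "i < r" for i
    by (rule subsetD[OF sub nth_mem]) (use that \<open>length vs = r\<close> in simp)
  have vs: "length vs = r" "\<And>i. i < r \<Longrightarrow> vs ! i \<in> interior_cells P"
      "\<And>i. i < r \<Longrightarrow> solid_square (vs ! i) l \<inter> curve P = {}"
      "\<And>i j. i < j \<Longrightarrow> j < r \<Longrightarrow> vs ! i \<notin> lattice_square (vs ! j) (2 * l)"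
    using \<open>length vs = r\<close> nth sorted by (simp_all add: sorted_wrt_iff_nth_less)
  have len: "length Qs = r" "length vs = length Qs" using Qs vs(1) by (auto simp: words_def)
  define hole where "hole i = translate (vs ! i) (Qs ! i)" for i
  have Q: "Qs ! i \<in> representatives C" if "i < r" for i using Qs that by (auto simp: words_def)
  then have hole_C: "hole i \<in> C" if "i < r" for i
    using that polygon_classD(2)[OF C] by (simp add: hole_def representatives_def)
  have hole_sub: "curve (hole i) \<subseteq> solid_square (vs ! i) l" if "i < r" for i
  proof (rule curve_subset_solid_square)
    have "\<Union>(Qs ! i) \<subseteq> lattice_square 0 l" using l(2)[of "Qs ! i"] that len by simp
    then show "\<Union>(hole i) \<subseteq> lattice_square (vs ! i) l"
      unfolding hole_def Union_translate by (fastforce simp: mem_lattice_square)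
  qed
  have hole_ne: "curve (hole i) \<noteq> {}" if "i < r" for i
  proof -
    have "self_avoiding_polygon (hole i)" using polygon_classD(1)[OF C hole_C[OF that]] .
    from point_mem_curve[OF sap_anchor_mem[OF this]] show ?thesis by blast
  qed
  have hole_in: "curve (hole i) \<subseteq> inside (curve P)" if "i < r" for i
    using hole_sub[OF that] solid_square_subset_inside[OF vs(2)[OF that] vs(3)[OF that] l(1)] by blast
  have hole_P: "curve (hole i) \<inter> curve P = {}" if "i < r" for i
    using hole_sub[OF that] vs(3)[OF that] by blast
  \<comment> \<open>\<open>sorted_wrt\<close> compares an entry only with later ones; the other
    order follows from the symmetry of intersection.\<close>
  have hole_less: "curve (hole i) \<inter> curve (hole j) = {}" if "i < j" "j < r" for i j
    using hole_sub[of i] hole_sub[of j] solid_squares_disjoint[OF vs(4)[OF that]] that by fastforce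
  then have hole_disj: "curve (hole i) \<inter> curve (hole j) = {}" if "i \<noteq> j" "i < r" "j < r" for i j
    using that by (metis inf_commute linorder_neqE_nat)
  have place: "place vs Qs ! i = hole i" if "i < r" for i
    using that len by (simp add: nth_place hole_def)
  have set: "set (place vs Qs) = hole ` {..<r}"
    using place len by (force simp: set_conv_nth length_place)
  \<comment> \<open>Disjoint nonempty curves cannot coincide, so different indices yield different
    holes.\<close>
  have inj: "inj_on hole {..<r}"
    using hole_disj hole_ne by (metis (no_types, lifting) inf.idem inj_onI lessThan_iff)
  then have dist: "distinct (place vs Qs)"
    using place len by (auto simp: distinct_conv_nth length_place inj_on_def)
  have "disjoint_family_on curve (insert P (set (place vs Qs)))"
  proof -
    have "curve S \<inter> curve S' = {}"
      if "S \<in> insert P (hole ` {..<r})" "S' \<in> insert P (hole ` {..<r})" "S \<noteq> S'" for S S'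
      using that hole_P hole_disj by (elim insertE imageE) (simp_all add: Int_commute, metis lessThan_iff)
    then show ?thesis unfolding disjoint_family_on_def set by blast
  qed
  moreover have "P \<in> C" using P by (simp add: representatives_def)
  moreover have "card (set (place vs Qs)) = r" using distinct_card[OF dist] len by (simp add: length_place)
  ultimately have "(P, set (place vs Qs)) \<in> punctured_polygons C r"
    using hole_C hole_in by (auto simp: punctured_polygons_def set)
  then show "vs \<in> placements C P Qs"
    using len dist by (simp add: placements_def)
qed

text \<open>The losses are the cells whose square meets the boundary curve, bounded by
  \<open>card_cells_near_curve\<close>, and for each other hole the positions within
  \<open>2 * l\<close> of it, a square with \<open>4 * l + 1\<close> lattice points per
  side.\<close>

lemma card_placements_lower:
  assumes C: "polygon_class C" and P: "P \<in> representatives C" and Qs: "Qs \<in> words (representatives C) r"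
    and l: "l \<ge> 1" "\<And>Q. Q \<in> set Qs \<Longrightarrow> \<Union>Q \<subseteq> lattice_square 0 l"
  shows "(area P - (2 * card P * nat (2 * l + 3) ^ 2 + r * nat (4 * l + 1) ^ 2)) ^ r
    \<le> card (placements C P Qs)"
proof -
  let ?B = "{v. solid_square v l \<inter> curve P \<noteq> {}}"
  let ?T = "{v \<in> interior_cells P. solid_square v l \<inter> curve P = {}}"
  let ?R = "\<lambda>u v. u \<notin> lattice_square v (2 * l)"
  note sap = representatives_vertices(1)[OF C P]
  have finT: "finite ?T" using finite_interior_cells[OF sap] by simp
  have "area P - card ?B \<le> card (interior_cells P - ?B)"
    unfolding area_eq using card_cells_near_curve(2)[OF sap, of l] l by (intro diff_card_le_card_Diff) auto
  also have "interior_cells P - ?B = ?T" by auto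
  finally have "area P - 2 * card P * nat (2 * l + 3) ^ 2 \<le> card ?T"
    using card_cells_near_curve(1)[OF sap, of l] l by linarith
  then have "(area P - (2 * card P * nat (2 * l + 3) ^ 2 + r * nat (4 * l + 1) ^ 2)) ^ r
      \<le> (card ?T - r * nat (4 * l + 1) ^ 2) ^ r"
    by (intro power_mono) auto
  also have "\<dots> \<le> card {vs. length vs = r \<and> set vs \<subseteq> ?T \<and> sorted_wrt ?R vs}"
  proof (rule card_sorted_wrt_lists[OF finT])
    fix v
    have "card {u \<in> ?T. \<not> ?R u v} \<le> card (lattice_square v (2 * l))"
      by (rule card_mono) auto
    then show "card {u \<in> ?T. \<not> ?R u v} \<le> nat (4 * l + 1) ^ 2"
      using l by (simp add: card_lattice_square)
  qed simp
  also have "\<dots> \<le> card (placements C P Qs)"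
    by (rule card_mono[OF card_placements_upper(2)[OF C P Qs] far_placements_subset[OF C P Qs l]])
  finally show ?thesis .
qed

text \<open>For holes of half-perimeter at most \<open>s\<close>, radius and area are bounded by
  constants, so every loss is at most a constant times \<open>Suc (half_perimeter P)\<close>. The
  number \<open>B\<close> may depend on \<open>k\<close>, \<open>r\<close>, \<open>s\<close> and the
  class, but not on \<open>m\<close>.\<close>

lemma punctured_moment_lower:
  assumes C: "polygon_class C" and r: "r \<ge> 1"
  obtains B where "\<And>m. fps_nth (Abs_fps (\<lambda>m. area_moment C (k + r) m
      - B * real (Suc m) * area_moment C (k + r - 1) m) * fps_cutoff (Suc s) (moment_gf C 0) ^ r) m
    \<le> fact r * punctured_moment C r k m"
proof -
  define R where "R = representatives C"
  define Rs where "Rs = {Q \<in> R. half_perimeter Q \<le> s}"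
  \<comment> \<open>The inserted 0 keeps \<open>Max\<close> meaningful if no polygon is this
    small.\<close>
  define D where "D = Max (insert 0 (area ` Rs))"
  \<comment> \<open>The radius from \<open>sap_vertices_bound\<close>: every hole fits into the
    square of radius \<open>l\<close> around its anchor.\<close>
  define l where "l = 8 * int s + 4"
  \<comment> \<open>The summands stand for the boundary, the mutual distance of the holes, and the
    area they remove. The 4 comes from
    \<open>2 * card P \<le> 4 * Suc (half_perimeter P)\<close>.\<close>
  define c where "c = 4 * nat (2 * l + 3) ^ 2 + r * nat (4 * l + 1) ^ 2 + r * D"
  \<comment> \<open>The factor \<open>k + r\<close> is the exponent in Bernoulli's
    inequality.\<close>
  define B where "B = real (k + r) * real c"
  have fin: "finite {P \<in> R. half_perimeter P \<le> m}" for m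
    unfolding R_def by (rule finite_representatives[OF C])
  have fins: "finite {P \<in> Rs. half_perimeter P \<le> m}" for m
    using fin[of m] by (rule rev_finite_subset) (auto simp: Rs_def)
  have D: "area Q \<le> D" if "Q \<in> Rs" for Q
    unfolding D_def using that fin[of s] by (intro Max_ge) (auto simp: Rs_def)
  have F: "Abs_fps (\<lambda>m. area_moment C (k + r) m - B * real (Suc m) * area_moment C (k + r - 1) m)
      = weight_gf R half_perimeter
          (\<lambda>P. real (area P) ^ (k + r) - B * real (Suc (half_perimeter P)) * real (area P) ^ (k + r - 1))"
    unfolding weight_gf_def area_moment_eq[OF C] R_def[symmetric] sum_distrib_left sum_subtractf[symmetric]
    by (rule arg_cong[of _ _ Abs_fps], rule ext, rule sum.cong) auto
  have G: "fps_cutoff (Suc s) (moment_gf C 0) = weight_gf Rs half_perimeter (\<lambda>_. 1)"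
  proof (rule fps_ext)
    fix m
    have "{P \<in> Rs. half_perimeter P = m} = (if m \<le> s then {P \<in> R. half_perimeter P = m} else {})"
      by (auto simp: Rs_def)
    then show "fps_nth (fps_cutoff (Suc s) (moment_gf C 0)) m = fps_nth (weight_gf Rs half_perimeter (\<lambda>_. 1)) m"
      by (simp add: moment_gf_eq[OF C] weight_gf_def flip: R_def)
  qed
  have main: "real (area P) ^ (k + r) - B * real (Suc (half_perimeter P)) * real (area P) ^ (k + r - 1)
      \<le> real (card (placements C P Qs)) * nonneg_power k (net_area P Qs)"
    if P: "P \<in> R" and Qs: "Qs \<in> words Rs r" for P Qs
  proof -
    define E where "E = c * Suc (half_perimeter P)"
    have QsR: "Qs \<in> words (representatives C) r" and Qs': "\<And>Q. Q \<in> set Qs \<Longrightarrow> Q \<in> Rs" "length Qs = r"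
      using Qs by (auto simp: words_def Rs_def R_def)
    have sq: "\<Union>Q \<subseteq> lattice_square 0 l" if "Q \<in> set Qs" for Q
    proof -
      have "\<Union>Q \<subseteq> lattice_square 0 (8 * int (half_perimeter Q) + 4)" "half_perimeter Q \<le> s"
        using Qs'(1)[OF that] representatives_vertices(3)[OF C, of Q] by (auto simp: Rs_def R_def)
      then show ?thesis by (fastforce simp: l_def mem_lattice_square)
    qed
    have cP: "2 * card P \<le> 4 * Suc (half_perimeter P)"
      using card_le_half_perimeter[of P] by simp
    have "2 * card P * nat (2 * l + 3) ^ 2 + r * nat (4 * l + 1) ^ 2
        \<le> 4 * Suc (half_perimeter P) * nat (2 * l + 3) ^ 2 + r * nat (4 * l + 1) ^ 2 * Suc (half_perimeter P)"
      by (rule add_mono[OF mult_right_mono[OF cP]]) simp_all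
    also have "\<dots> \<le> E" by (simp add: E_def c_def algebra_simps)
    finally have e: "2 * card P * nat (2 * l + 3) ^ 2 + r * nat (4 * l + 1) ^ 2 \<le> E" .
    have rD: "r * D \<le> E" by (simp add: E_def c_def algebra_simps)
    have "real (area P) ^ (k + r) - real (k + r) * real E * real (area P) ^ (k + r - 1)
        \<le> real (area P - E) ^ (k + r)"
      using r by (intro bernoulli_truncated_diff) simp
    \<comment> \<open>Of the \<open>k + r\<close> factors, \<open>r\<close> are matched with the
      number of placements and \<open>k\<close> with the net area.\<close>
    also have "\<dots> = real ((area P - E) ^ r) * real (area P - E) ^ k"
      by (simp add: power_add mult.commute)
    also have "\<dots> \<le> real (card (placements C P Qs)) * nonneg_power k (net_area P Qs)"
    proof (cases "area P \<le> E")
      case True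
      \<comment> \<open>As \<open>r \<ge> 1\<close>, the truncated difference makes the left-hand
        side 0.\<close>
      then show ?thesis using r by (simp add: nonneg_power_nonneg zero_power)
    next
      case False
      have "l \<ge> 1" by (simp add: l_def)
      have "(area P - E) ^ r \<le> (area P - (2 * card P * nat (2 * l + 3) ^ 2 + r * nat (4 * l + 1) ^ 2)) ^ r"
        using e by (intro power_mono) auto
      also have "\<dots> \<le> card (placements C P Qs)"
        using P QsR \<open>l \<ge> 1\<close> sq by (intro card_placements_lower[OF C]) (auto simp: R_def)
      finally have card_ge: "(area P - E) ^ r \<le> card (placements C P Qs)" .
      have "sum_list (map area Qs) \<le> r * D"
        using sum_list_le_length_mult[of Qs area D] D Qs' by simp
      moreover have "(\<Sum>Q\<leftarrow>Qs. int (area Q)) = int (sum_list (map area Qs))"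
        by (induction Qs) auto
      ultimately have "int (area P - E) \<le> net_area P Qs"
        using False rD unfolding net_area_def by linarith
      then have "real (area P - E) ^ k \<le> nonneg_power k (net_area P Qs)"
        unfolding nonneg_power_def by (auto intro!: power_mono)
      with card_ge show ?thesis
        by (intro mult_mono) (auto simp del: of_nat_power)
    qed
    also have "real (k + r) * real E = B * real (Suc (half_perimeter P))"
      by (simp only: B_def E_def of_nat_mult mult.assoc)
    finally show ?thesis .
  qed
  have "fps_nth (Abs_fps (\<lambda>m. area_moment C (k + r) m
      - B * real (Suc m) * area_moment C (k + r - 1) m) * fps_cutoff (Suc s) (moment_gf C 0) ^ r) m
    \<le> fact r * punctured_moment C r k m" for m
  proof -
    let ?I = "{(P, Qs). P \<in> R \<and> Qs \<in> words Rs r \<and> half_perimeter P + sum_list (map half_perimeter Qs) = m}"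
    have sub: "?I \<subseteq> configurations C r m"
      by (auto simp: configurations_def words_def Rs_def R_def)
    have "fps_nth (Abs_fps (\<lambda>m. area_moment C (k + r) m
        - B * real (Suc m) * area_moment C (k + r - 1) m) * fps_cutoff (Suc s) (moment_gf C 0) ^ r) m
      = (\<Sum>(P, Qs)\<in>?I. real (area P) ^ (k + r)
          - B * real (Suc (half_perimeter P)) * real (area P) ^ (k + r - 1))"
      unfolding F G by (rule weight_gf_mult_power[OF fin fins])
    also have "\<dots> \<le> (\<Sum>(P, Qs)\<in>?I. real (card (placements C P Qs)) * nonneg_power k (net_area P Qs))"
      using main by (intro sum_mono) auto
    \<comment> \<open>Larger holes are added only now, when all summands are nonnegative; the
      differences in the preceding sum can be negative.\<close>
    also have "\<dots> \<le> (\<Sum>(P, Qs)\<in>configurations C r m.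
        real (card (placements C P Qs)) * nonneg_power k (net_area P Qs))"
      using finite_configurations[OF C] sub
      by (intro sum_mono2) (auto simp: nonneg_power_nonneg)
    finally show ?thesis by (simp add: punctured_moment_configurations[OF C])
  qed
  then show ?thesis by (rule that)
qed

section \<open>Asymptotics of the punctured moments\<close>

lemma powr_Suc_asymp_equiv: "(\<lambda>m. real m powr a) \<sim>[sequentially] (\<lambda>m. real (Suc m) powr a)"
proof (rule asymp_equivI')
  have "(\<lambda>m. real m / real (Suc m)) \<longlonglongrightarrow> 1" by (rule LIMSEQ_n_over_Suc_n)
  then have "(\<lambda>m. (real m / real (Suc m)) powr a) \<longlonglongrightarrow> 1 powr a"
    by (intro tendsto_powr tendsto_const) auto
  then show "(\<lambda>m. real m powr a / real (Suc m) powr a) \<longlonglongrightarrow> 1"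
    by (simp add: powr_divide)
qed

text \<open>Passing from \<open>m powr a\<close> to \<open>Suc m powr a\<close> avoids the junk value at \<open>m = 0\<close>.\<close>

lemma asymp_equiv_power_law_iff:
  assumes x: "x > 0" and A: "A \<noteq> 0"
  shows "f \<sim>[sequentially] (\<lambda>m. A * x powr (- real m) * real m powr a)
    \<longleftrightarrow> (\<lambda>m. f m * x ^ m / real (Suc m) powr a) \<longlonglongrightarrow> A"
proof -
  define u where "u m = x powr (- real m) * real (Suc m) powr a" for m
  have u: "u m \<noteq> 0" "f m * x ^ m / real (Suc m) powr a = f m / u m" for m
    using x by (simp_all add: u_def powr_minus powr_realpow field_simps)
  have "(\<lambda>m. A * x powr (- real m) * real m powr a) \<sim>[sequentially] (\<lambda>m. A * u m)"
    unfolding u_def mult.assoc by (intro asymp_equiv_intros powr_Suc_asymp_equiv)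
  then have "f \<sim>[sequentially] (\<lambda>m. A * x powr (- real m) * real m powr a)
      \<longleftrightarrow> f \<sim>[sequentially] (\<lambda>m. A * u m)"
    by (meson asymp_equiv_sym asymp_equiv_trans)
  also have "\<dots> \<longleftrightarrow> (\<lambda>m. f m / u m) \<longlonglongrightarrow> A"
  proof
    assume "f \<sim>[sequentially] (\<lambda>m. A * u m)"
    then have "(\<lambda>m. f m / u m) \<sim>[sequentially] (\<lambda>m. A * u m / u m)"
      by (intro asymp_equiv_intros)
    then have "(\<lambda>m. f m / u m) \<sim>[sequentially] (\<lambda>_. A)" using u by simp
    then show "(\<lambda>m. f m / u m) \<longlonglongrightarrow> A" by (rule asymp_equivD_const)
  next
    assume "(\<lambda>m. f m / u m) \<longlonglongrightarrow> A"
    from tendsto_divide[OF this tendsto_const[of A] A] A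
    have "(\<lambda>m. f m / (A * u m)) \<longlonglongrightarrow> 1" by (simp add: mult.commute)
    then show "f \<sim>[sequentially] (\<lambda>m. A * u m)" by (rule asymp_equivI')
  qed
  finally show ?thesis unfolding u(2) .
qed

lemma area_moment_nonneg: "polygon_class C \<Longrightarrow> area_moment C k m \<ge> 0"
  by (simp add: area_moment_eq sum_nonneg)

text \<open>A real limit \<open>P\<^sub>0\<close> expresses that the value at
  \<open>x\<^sub>c\<close> is finite; it is chosen before \<open>k\<close>, so one value serves all
  moments.\<close>

theorem theorem2:
  fixes C :: "polygon set" and A \<gamma> :: "nat \<Rightarrow> real" and x\<^sub>c \<theta> \<phi> :: real and r :: nat
  assumes "polygon_class C"
    and "\<And>k. A k > 0" and "x\<^sub>c > 0" and "0 < \<phi>" and "\<phi> < 1"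
    and "\<And>k. \<gamma> k = (real k - \<theta>) / \<phi>"
    and "\<And>k. (\<lambda>m. area_moment C k m) \<sim>[sequentially]
                (\<lambda>m. A k * x\<^sub>c powr (- real m) * real m powr (\<gamma> k - 1))"
    and "r \<ge> 1"
  shows "(\<forall>k m. punctured_moment C r k m
              \<le> fps_nth (moment_gf C (k + r) * moment_gf C 0 ^ r) m / fact r) \<and>
         (\<theta> > 0 \<longrightarrow>
           (\<exists>P\<^sub>0. (eval_fps (moment_gf C 0) \<longlongrightarrow> P\<^sub>0) (at_left x\<^sub>c) \<and>
             (\<forall>k. (\<lambda>m. punctured_moment C r k m) \<sim>[sequentially]
                    (\<lambda>m. fps_nth (moment_gf C (k + r) * moment_gf C 0 ^ r) m / fact r) \<and>
                  (\<lambda>m. fps_nth (moment_gf C (k + r) * moment_gf C 0 ^ r) m / fact r) \<sim>[sequentially]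
                    (\<lambda>m. A (k + r) * P\<^sub>0 ^ r / fact r * x\<^sub>c powr (- real m)
                           * real m powr (\<gamma> (k + r) - 1)))))"
proof (intro conjI allI impI)
  note C = assms(1) and x = assms(3) and \<phi> = assms(4,5) and \<gamma> = assms(6)
  show "punctured_moment C r k m \<le> fps_nth (moment_gf C (k + r) * moment_gf C 0 ^ r) m / fact r" for k m
    using punctured_moment_upper[OF C, of r k m] by (simp add: field_simps)
  assume \<theta>: "\<theta> > 0"
  let ?G = "moment_gf C 0"
  define \<beta> where "\<beta> = \<gamma> 0 - 1"
  \<comment> \<open>Positivity of \<theta> enters here:
    \<open>\<gamma> 0 = - \<theta> / \<phi>\<close> is negative.\<close>
  have \<beta>: "\<beta> < -1" using \<theta> \<phi> by (simp add: \<beta>_def \<gamma>)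
  have moment_lim: "(\<lambda>m. scaled_coeff x\<^sub>c (moment_gf C j) m / real (Suc m) powr (\<gamma> j - 1)) \<longlonglongrightarrow> A j" for j
    using assms(7)[of j] asymp_equiv_power_law_iff[OF x, of "A j"] assms(2)[of j]
    by (simp add: scaled_coeff_def moment_gf_def)
  have G_nonneg: "scaled_coeff x\<^sub>c ?G m \<ge> 0" for m
    using x by (simp add: scaled_coeff_def moment_gf_def area_moment_nonneg[OF C])
  obtain B where B: "\<And>m. \<bar>scaled_coeff x\<^sub>c ?G m / real (Suc m) powr \<beta>\<bar> \<le> B"
    using convergent_imp_Bseq[OF convergentI[OF moment_lim[of 0]]] unfolding Bseq_def \<beta>_def by auto
  have G_bound: "\<bar>scaled_coeff x\<^sub>c ?G m\<bar> \<le> B * real (Suc m) powr \<beta>" for m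
    using B[of m] by (simp add: divide_simps split: if_splits)
  have G_abs_summable: "summable (\<lambda>m. \<bar>scaled_coeff x\<^sub>c ?G m\<bar>)"
    by (rule summable_comparison_test'[OF summable_mult[OF summable_Suc_powr[OF \<beta>]], of 0])
       (use G_bound in simp)
  then have G_summable: "summable (scaled_coeff x\<^sub>c ?G)" by (rule summable_rabs_cancel)
  define P where "P = (\<Sum>m. scaled_coeff x\<^sub>c ?G m)"
  \<comment> \<open>The limit constant must be nonzero for asymptotic equivalence to be read off
    from a limit of quotients.\<close>
  have "P > 0"
  proof -
    have "eventually (\<lambda>m. scaled_coeff x\<^sub>c ?G m / real (Suc m) powr (\<gamma> 0 - 1) > 0) sequentially"
      using order_tendstoD(1)[OF moment_lim[of 0] assms(2)] .
    from eventually_happens'[OF sequentially_bot this]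
    obtain m where "scaled_coeff x\<^sub>c ?G m / real (Suc m) powr (\<gamma> 0 - 1) > 0" by blast
    then have "scaled_coeff x\<^sub>c ?G m > 0" by (simp add: zero_less_divide_iff)
    then show ?thesis unfolding P_def using G_nonneg by (intro suminf_pos2[OF G_summable])
  qed
  \<comment> \<open>Both sequences are compared with the same explicit power law; their mutual
    equivalence then follows by transitivity.\<close>
  have "(\<lambda>m. punctured_moment C r k m) \<sim>[sequentially]
          (\<lambda>m. A (k + r) * P ^ r / fact r * x\<^sub>c powr (- real m) * real m powr (\<gamma> (k + r) - 1)) \<and>
        (\<lambda>m. fps_nth (moment_gf C (k + r) * ?G ^ r) m / fact r) \<sim>[sequentially]
          (\<lambda>m. A (k + r) * P ^ r / fact r * x\<^sub>c powr (- real m) * real m powr (\<gamma> (k + r) - 1))" for k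
  proof -
    define \<alpha> where "\<alpha> = \<gamma> (k + r) - 1"
    define L where "L = A (k + r) * P ^ r"
    have "L / fact r \<noteq> 0" using assms(2)[of "k + r"] \<open>P > 0\<close> by (simp add: L_def)
    have "\<gamma> 0 < \<gamma> (k + r)" unfolding \<gamma> using \<phi> assms(8) by (intro divide_strict_right_mono) auto
    then have \<beta>\<alpha>: "\<beta> < \<alpha>" by (simp add: \<alpha>_def \<beta>_def)
    note power_limit = scaled_coeff_mult_power_limit[OF \<beta> \<beta>\<alpha>]
    have upper_lim: "(\<lambda>m. scaled_coeff x\<^sub>c (moment_gf C (k + r) * ?G ^ r) m / real (Suc m) powr \<alpha>) \<longlonglongrightarrow> L"
      unfolding L_def P_def \<alpha>_def by (rule power_limit[OF moment_lim[of "k + r", folded \<alpha>_def] G_bound, unfolded \<alpha>_def])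
    define low where "low B' = Abs_fps (\<lambda>m. area_moment C (k + r) m
      - B' * real (Suc m) * area_moment C (k + r - 1) m)" for B'
    have low_lim: "(\<lambda>m. scaled_coeff x\<^sub>c (low B') m / real (Suc m) powr \<alpha>) \<longlonglongrightarrow> A (k + r)" for B'
    proof -
      let ?a = "\<lambda>m. scaled_coeff x\<^sub>c (moment_gf C (k + r)) m / real (Suc m) powr \<alpha>"
      let ?b = "\<lambda>m. scaled_coeff x\<^sub>c (moment_gf C (k + r - 1)) m / real (Suc m) powr (\<gamma> (k + r - 1) - 1)"
      \<comment> \<open>The weight \<open>Suc m\<close> raises the exponent by 1, while lowering the
        order of the moment by one costs \<open>1 / \<phi>\<close>.\<close>
      have "(\<gamma> (k + r - 1) - 1) - \<alpha> + 1 = 1 - 1 / \<phi>"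
        using assms(8) \<phi> by (simp add: \<gamma> \<alpha>_def of_nat_diff field_simps)
      also have "\<dots> < 0" using \<phi> by simp
      finally have "(\<lambda>m. real (Suc m) powr ((\<gamma> (k + r - 1) - 1) - \<alpha> + 1)) \<longlonglongrightarrow> 0"
        by (intro LIMSEQ_Suc tendsto_neg_powr filterlim_real_sequentially)
      from tendsto_diff[OF moment_lim[of "k + r", folded \<alpha>_def]
          tendsto_mult[OF tendsto_mult[OF tendsto_const[of B'] moment_lim[of "k + r - 1"]] this]]
      have "(\<lambda>m. ?a m - B' * ?b m * real (Suc m) powr ((\<gamma> (k + r - 1) - 1) - \<alpha> + 1)) \<longlonglongrightarrow> A (k + r)"
        by simp
      moreover have "?a m - B' * ?b m * real (Suc m) powr ((\<gamma> (k + r - 1) - 1) - \<alpha> + 1)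
          = scaled_coeff x\<^sub>c (low B') m / real (Suc m) powr \<alpha>" for m
      proof -
        have "real (Suc m) powr ((\<gamma> (k + r - 1) - 1) - \<alpha> + 1)
            = real (Suc m) powr (\<gamma> (k + r - 1) - 1) / real (Suc m) powr \<alpha> * real (Suc m)"
          by (subst powr_add) (simp add: powr_diff)
        then show ?thesis
          by (simp add: scaled_coeff_def moment_gf_def low_def diff_divide_distrib left_diff_distrib)
      qed
      ultimately show ?thesis by simp
    qed
    have cutoff_sum: "(\<Sum>m. scaled_coeff x\<^sub>c (fps_cutoff (Suc s) ?G) m) = (\<Sum>m<Suc s. scaled_coeff x\<^sub>c ?G m)" for s
    proof -
      have "(\<Sum>m. scaled_coeff x\<^sub>c (fps_cutoff (Suc s) ?G) m) = (\<Sum>m<Suc s. scaled_coeff x\<^sub>c (fps_cutoff (Suc s) ?G) m)"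
        by (rule suminf_finite) (auto simp: scaled_coeff_def)
      then show ?thesis by (simp add: scaled_coeff_def)
    qed
    \<comment> \<open>Cutting off replaces coefficients by 0, so the bound for the full series is
      inherited for every \<open>s\<close>.\<close>
    have cutoff_bound: "\<bar>scaled_coeff x\<^sub>c (fps_cutoff (Suc s) ?G) m\<bar> \<le> B * real (Suc m) powr \<beta>" for s m
      using G_bound[of m] abs_ge_zero[of "scaled_coeff x\<^sub>c ?G m"] by (auto simp: scaled_coeff_def)
    let ?U = "\<lambda>m. fact r * punctured_moment C r k m * x\<^sub>c ^ m / real (Suc m) powr \<alpha>"
    \<comment> \<open>The cutoff \<open>s\<close> is chosen from \<open>a\<close> before
      \<open>m\<close> grows, so \<open>B'\<close> may depend on it: for each fixed
      \<open>B'\<close> the correction disappears in the limit, and the partial sums tend to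
      \<open>P\<close> as \<open>s\<close> grows.\<close>
    have U_lim: "?U \<longlonglongrightarrow> L"
    proof (rule order_tendstoI)
      fix a assume "a < L"
      have "(\<lambda>s. A (k + r) * (\<Sum>m<Suc s. scaled_coeff x\<^sub>c ?G m) ^ r) \<longlonglongrightarrow> L"
        unfolding L_def P_def
        by (intro tendsto_intros LIMSEQ_Suc summable_LIMSEQ G_summable)
      from eventually_happens'[OF sequentially_bot order_tendstoD(1)[OF this \<open>a < L\<close>]]
      obtain s where s: "a < A (k + r) * (\<Sum>m<Suc s. scaled_coeff x\<^sub>c ?G m) ^ r" by blast
      obtain B' where B': "\<And>m. fps_nth (low B' * fps_cutoff (Suc s) ?G ^ r) m \<le> fact r * punctured_moment C r k m"
        using punctured_moment_lower[OF C assms(8), of k s] unfolding low_def by blast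
      have "(\<lambda>m. scaled_coeff x\<^sub>c (low B' * fps_cutoff (Suc s) ?G ^ r) m / real (Suc m) powr \<alpha>)
          \<longlonglongrightarrow> A (k + r) * (\<Sum>m<Suc s. scaled_coeff x\<^sub>c ?G m) ^ r"
        unfolding cutoff_sum[symmetric] by (rule power_limit[OF low_lim cutoff_bound])
      from order_tendstoD(1)[OF this s] show "eventually (\<lambda>m. a < ?U m) sequentially"
      proof eventually_elim
        case (elim m)
        also have "scaled_coeff x\<^sub>c (low B' * fps_cutoff (Suc s) ?G ^ r) m / real (Suc m) powr \<alpha> \<le> ?U m"
          unfolding scaled_coeff_def using x B' by (intro divide_right_mono mult_right_mono) auto
        finally show ?case .
      qed
    next
      fix a assume "L < a"
      from order_tendstoD(2)[OF upper_lim this] show "eventually (\<lambda>m. ?U m < a) sequentially"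
      proof eventually_elim
        case (elim m)
        have "?U m \<le> scaled_coeff x\<^sub>c (moment_gf C (k + r) * ?G ^ r) m / real (Suc m) powr \<alpha>"
          unfolding scaled_coeff_def using x punctured_moment_upper[OF C]
          by (intro divide_right_mono mult_right_mono) auto
        with elim show ?case by simp
      qed
    qed
    from tendsto_divide[OF U_lim tendsto_const[of "fact r"]]
    have "(\<lambda>m. punctured_moment C r k m * x\<^sub>c ^ m / real (Suc m) powr \<alpha>) \<longlonglongrightarrow> L / fact r"
      by simp
    moreover from tendsto_divide[OF upper_lim tendsto_const[of "fact r"]]
    have "(\<lambda>m. fps_nth (moment_gf C (k + r) * ?G ^ r) m / fact r * x\<^sub>c ^ m / real (Suc m) powr \<alpha>)
        \<longlonglongrightarrow> L / fact r"
      by (simp add: scaled_coeff_def mult_ac)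
    ultimately show ?thesis
      using asymp_equiv_power_law_iff[OF x \<open>L / fact r \<noteq> 0\<close>] by (simp add: L_def \<alpha>_def)
  qed
  then show "\<exists>P\<^sub>0. (eval_fps ?G \<longlongrightarrow> P\<^sub>0) (at_left x\<^sub>c) \<and>
      (\<forall>k. (\<lambda>m. punctured_moment C r k m) \<sim>[sequentially]
             (\<lambda>m. fps_nth (moment_gf C (k + r) * ?G ^ r) m / fact r) \<and>
           (\<lambda>m. fps_nth (moment_gf C (k + r) * ?G ^ r) m / fact r) \<sim>[sequentially]
             (\<lambda>m. A (k + r) * P\<^sub>0 ^ r / fact r * x\<^sub>c powr (- real m) * real m powr (\<gamma> (k + r) - 1)))"
    using eval_fps_at_left_limit[OF x G_abs_summable] unfolding P_def
    by (meson asymp_equiv_sym asymp_equiv_trans)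
qed

end
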